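(* Let $N$ be a left $\mathcal{A}^{\mathbb{R}}_\star$-comodule with coaction $\psi_L:N\to\mathcal{A}^{\mathbb{R}}_\star\otimes_{\mathbb{M}_2^{\mathbb{R}}}N$. Then, for $n\in N$ and $\varphi\in\mathcal{A}^{\mathbb{R}}$, the formula $$\varphi\cdot n=(\varphi c\otimes\mathrm{id})\,\psi_L(n)$$ defines a left $\mathcal{A}^{\mathbb{R}}$-module structure on $N$. Here $\varphi c$ is the composite $\mathcal{A}^{\mathbb{R}}_\star\xrightarrow{c}\mathcal{A}^{\mathbb{R}}_\star\xrightarrow{\varphi}\mathbb{M}_2^{\mathbb{R}}$ of the conjugation with $\varphi$, and $\mathbb{M}_2^{\mathbb{R}}\otimes_{\mathbb{M}_2^{\mathbb{R}}}N$ is identified with $N$.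
   Context: $\mathbb{M}_2^{\mathbb{R}}=\mathbb{F}_2[\tau,\rho]$ (homological bidegrees $|\tau|=(0,-1)$, $|\rho|=(-1,-1)$). The $\mathbb{R}$-motivic dual Steenrod algebra is $\mathcal{A}^{\mathbb{R}}_\star=\mathbb{M}_2^{\mathbb{R}}[\tau_0,\tau_1,\dots,\xi_1,\xi_2,\dots]/(\tau_n^2=\tau\xi_{n+1}+\rho\tau_0\xi_{n+1}+\rho\tau_{n+1})$, $|\tau_i|=(2^{i+1}-1,2^i-1)$, $|\xi_i|=(2^{i+1}-2,2^i-1)$, a Hopf algebroid over $\mathbb{M}_2^{\mathbb{R}}$ with units $\eta_L(\tau)=\tau$, $\eta_R(\tau)=\tau+\rho\tau_0$, $\eta_L(\rho)=\eta_R(\rho)=\rho$; comultiplication $\Delta(\xi_n)=\sum_{i=0}^n\xi_{n-i}^{2^i}\otimes\xi_i$, $\Delta(\tau_n)=\tau_n\otimes1+\sum_{i=0}^n\xi_{n-i}^{2^i}\otimes\tau_i$ ($\xi_0=1$); counit killing all $\tau_i$ and all $\xi_i$, $i\ge1$; and conjugation $c$, the ring map with $c(\rho)=\rho$, $c(\tau)=\tau+\rho\tau_0$, $c(\xi_n)=\sum_{i=0}^{n-1}\xi_{n-i}^{2^i}c(\xi_i)$, $c(\tau_n)=\tau_n+\sum_{i=0}^{n-1}\xi_{n-i}^{2^i}c(\tau_i)$. The left and right $\mathbb{M}_2^{\mathbb{R}}$-module structures on $\mathcal{A}^{\mathbb{R}}_\star$ are multiplication through $\eta_L$ and $\eta_R$;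 $c$ interchanges them, so $\varphi c$ is a right $\mathbb{M}_2^{\mathbb{R}}$-module map. In $\mathcal{A}^{\mathbb{R}}_\star\otimes_{\mathbb{M}_2^{\mathbb{R}}}N$ the right structure on $\mathcal{A}^{\mathbb{R}}_\star$ is used; a left comodule is a (left) $\mathbb{M}_2^{\mathbb{R}}$-module $N$ with a left $\mathbb{M}_2^{\mathbb{R}}$-linear, coassociative, counital coaction $\psi_L$. The $\mathbb{R}$-motivic Steenrod algebra is $\mathcal{A}^{\mathbb{R}}=\mathrm{Hom}_{\mathbb{M}_2^{\mathbb{R}}}(\mathcal{A}^{\mathbb{R}}_\star,\mathbb{M}_2^{\mathbb{R}})$ (bigraded left-linear maps), with product $(\varphi\psi)(a)=\sum\varphi(a'\,\eta_R(\psi(a'')))$ where $\Delta(a)=\sum a'\otimes a''$, and unit the counit of $\mathcal{A}^{\mathbb{R}}_\star$. *)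

theory Defs
  imports
    Complex_Main
    "HOL-Library.Poly_Mapping"
    "HOL-Library.Z2"
    "HOL-Library.Product_Plus"
    "HOL-Algebra.Ring"
begin

section \<open>Polynomials\<close>

text \<open>
  A polynomial over \<open>'r\<close> in variables \<open>'v\<close> is a finitely supported function on monomials, and a
  monomial is a finitely supported function from variables to exponents. The ring structure is the
  convolution product of \<^theory>\<open>HOL-Library.Poly_Mapping\<close>.
\<close>

type_synonym ('v, 'r) mpoly = "('v \<Rightarrow>\<^sub>0 nat) \<Rightarrow>\<^sub>0 'r"

definition Var :: "'v \<Rightarrow> ('v, 'r::zero_neq_one) mpoly" where
  "Var v = Poly_Mapping.single (Poly_Mapping.single v 1) 1"

definition Const :: "'r::zero \<Rightarrow> ('v, 'r) mpoly" where
  "Const c = Poly_Mapping.single 0 c"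

definition monom_eval :: "('v \<Rightarrow> 'a::comm_ring_1) \<Rightarrow> ('v \<Rightarrow>\<^sub>0 nat) \<Rightarrow> 'a" where
  "monom_eval g m = (\<Prod>v\<in>Poly_Mapping.keys m. g v ^ Poly_Mapping.lookup m v)"

definition poly_eval :: "('r::zero \<Rightarrow> 'a::comm_ring_1) \<Rightarrow> ('v \<Rightarrow> 'a) \<Rightarrow> ('v, 'r) mpoly \<Rightarrow> 'a" where
  "poly_eval h g p =
     (\<Sum>m\<in>Poly_Mapping.keys p. h (Poly_Mapping.lookup p m) * monom_eval g m)"

definition monom_degree :: "('v \<Rightarrow> int \<times> int) \<Rightarrow> ('v \<Rightarrow>\<^sub>0 nat) \<Rightarrow> int \<times> int" where
  "monom_degree deg m =
     (\<Sum>v\<in>Poly_Mapping.keys m.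
        (int (Poly_Mapping.lookup m v) * fst (deg v), int (Poly_Mapping.lookup m v) * snd (deg v)))"

definition ring_map :: "('r::ring_1 \<Rightarrow> 's::ring_1) \<Rightarrow> bool" where
  "ring_map h \<longleftrightarrow>
     h 1 = 1 \<and> (\<forall>x y. h (x + y) = h x + h y) \<and> (\<forall>x y. h (x * y) = h x * h y)"

lemma ring_mapD:
  assumes "ring_map h"
  shows "h 1 = 1" "h 0 = 0" "h (x + y) = h x + h y" "h (x * y) = h x * h y"
    "h (- x) = - h x" "h (x - y) = h x - h y" "h (x ^ n) = h x ^ n"
proof -
  show 1: "h 1 = 1" and add: "h (x + y) = h x + h y" and mult: "h (x * y) = h x * h y" for x y
    using assms unfolding ring_map_def by blast+
  show 0: "h 0 = 0"
    using add[of 0 0] by simp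
  show m: "h (- x) = - h x" for x
    using add[of x "- x"] 0 by (simp add: eq_neg_iff_add_eq_0 add.commute)
  show "h (x - y) = h x - h y"
    using add[of x "- y"] m by simp
  show "h (x ^ n) = h x ^ n"
    by (induction n) (simp_all add: 1 mult)
qed

lemma ring_map_sum: "ring_map h \<Longrightarrow> h (\<Sum>i\<in>I. f i) = (\<Sum>i\<in>I. h (f i))"
  by (induction I rule: infinite_finite_induct) (simp_all add: ring_mapD)

lemma poly_mapping_monomial_induct [case_names zero add]:
  assumes "P 0" "\<And>p k c. P p \<Longrightarrow> P (p + Poly_Mapping.single k c)"
  shows "P (p :: 'k \<Rightarrow>\<^sub>0 'c::comm_monoid_add)"
proof (induction p rule: update_induct)
  case const
  then show ?case by (rule assms(1))
next
  case (update f k c)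
  have "Poly_Mapping.update k c f = f + Poly_Mapping.single k c"
    using update by (intro poly_mapping_eqI)
      (auto simp: lookup_update lookup_add lookup_single in_keys_iff when_def)
  with update assms(2) show ?case by simp
qed

lemma monom_eval_superset:
  assumes "finite S" "Poly_Mapping.keys m \<subseteq> S"
  shows "monom_eval g m = (\<Prod>v\<in>S. g v ^ Poly_Mapping.lookup m v)"
  unfolding monom_eval_def
  by (rule prod.mono_neutral_left) (use assms in \<open>auto simp: in_keys_iff\<close>)

lemma monom_eval_add: "monom_eval g (m + m') = monom_eval g m * monom_eval g m'"
proof -
  let ?S = "Poly_Mapping.keys m \<union> Poly_Mapping.keys m'"
  have "Poly_Mapping.keys (m + m') \<subseteq> ?S" by (rule Poly_Mapping.keys_add)
  then show ?thesis
    by (simp add: monom_eval_superset[of ?S] lookup_add power_add prod.distrib)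
qed

lemma monom_eval_single [simp]: "monom_eval g (Poly_Mapping.single v n) = g v ^ n"
  by (subst monom_eval_superset[of "{v}"]) auto

lemma monom_eval_0 [simp]: "monom_eval g 0 = 1"
  by (simp add: monom_eval_def)

lemma poly_eval_superset:
  assumes "finite S" "Poly_Mapping.keys p \<subseteq> S" "h 0 = 0"
  shows "poly_eval h g p = (\<Sum>m\<in>S. h (Poly_Mapping.lookup p m) * monom_eval g m)"
  unfolding poly_eval_def
  by (rule sum.mono_neutral_left) (use assms in \<open>auto simp: in_keys_iff\<close>)

lemma ring_map_poly_eval:
  fixes h :: "'r::comm_ring_1 \<Rightarrow> 'a::comm_ring_1"
  assumes h: "ring_map h"
  shows "ring_map (poly_eval h g)"
proof -
  note h0 = ring_mapD(2)[OF h]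
  have single: "poly_eval h g (Poly_Mapping.single m c) = h c * monom_eval g m" for m c
    by (subst poly_eval_superset[of "{m}"]) (auto simp: h0)
  have add: "poly_eval h g (p + q) = poly_eval h g p + poly_eval h g q" for p q
  proof -
    let ?S = "Poly_Mapping.keys p \<union> Poly_Mapping.keys q"
    have "Poly_Mapping.keys (p + q) \<subseteq> ?S" by (rule Poly_Mapping.keys_add)
    then show ?thesis
      by (simp add: poly_eval_superset[of ?S] h0 lookup_add ring_mapD(3)[OF h] algebra_simps
          sum.distrib)
  qed
  have zero: "poly_eval h g 0 = 0" by (simp add: poly_eval_def)
  have mult1: "poly_eval h g (p * Poly_Mapping.single m c)
      = poly_eval h g p * poly_eval h g (Poly_Mapping.single m c)" for p m c
    by (induction p rule: poly_mapping_monomial_induct)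
      (simp_all add: zero add single distrib_right mult_single monom_eval_add
        ring_mapD(4)[OF h], (simp only: mult_ac)?)
  have mult: "poly_eval h g (p * q) = poly_eval h g p * poly_eval h g q" for p q
    by (induction q rule: poly_mapping_monomial_induct)
      (simp_all add: zero add mult1 distrib_left)
  have one: "poly_eval h g 1 = 1"
    using single[of 0 1] ring_mapD(1)[OF h] by simp
  from one add mult show ?thesis by (simp add: ring_map_def)
qed

lemma poly_eval_Var [simp]: "ring_map h \<Longrightarrow> poly_eval h g (Var v) = g v"
  unfolding Var_def
  by (subst poly_eval_superset[of "{Poly_Mapping.single v 1}"]) (auto simp: ring_mapD)

lemma poly_eval_Const [simp]: "ring_map h \<Longrightarrow> poly_eval h g (Const c) = h c"
  unfolding Const_def
  by (subst poly_eval_superset[of "{0}"]) (auto simp: ring_mapD)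

lemma single_eq_Const_Var:
  "Poly_Mapping.single m (c :: 'r::comm_ring_1) = Const c * monom_eval Var m"
proof (induction m arbitrary: c rule: poly_mapping_monomial_induct)
  case zero
  then show ?case by (simp add: Const_def)
next
  case (add m v n)
  have "Poly_Mapping.single (Poly_Mapping.single v n) (1::'r) = Var v ^ n"
  proof (induction n)
    case (Suc n)
    have "Poly_Mapping.single (Poly_Mapping.single v (Suc n)) (1::'r)
        = Var v * Poly_Mapping.single (Poly_Mapping.single v n) 1"
      by (simp add: Var_def mult_single single_add[symmetric])
    with Suc show ?case by simp
  qed simp
  moreover have "Poly_Mapping.single (m + Poly_Mapping.single v n) c
      = Poly_Mapping.single m c * Poly_Mapping.single (Poly_Mapping.single v n) 1"
    by (simp add: mult_single)
  ultimately show ?case by (simp add: add monom_eval_add mult.assoc)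
qed

lemma mpoly_ring_map_eqI:
  fixes h h' :: "('v, 'r::comm_ring_1) mpoly \<Rightarrow> 'a::comm_ring_1"
  assumes h: "ring_map h" and h': "ring_map h'"
    and Const: "\<And>c. h (Const c) = h' (Const c)" and Var: "\<And>v. h (Var v) = h' (Var v)"
  shows "h p = h' p"
proof (induction p rule: poly_mapping_monomial_induct)
  case zero
  show ?case by (simp add: ring_mapD[OF h] ring_mapD[OF h'])
next
  case (add p m c)
  have "h (monom_eval Var m) = h' (monom_eval Var m)"
    by (induction m rule: poly_mapping_monomial_induct)
      (simp_all add: monom_eval_add ring_mapD[OF h] ring_mapD[OF h'] Var)
  with add show ?case
    by (simp add: ring_mapD[OF h] ring_mapD[OF h'] single_eq_Const_Var Const)
qed

lemma ring_map_Const: "ring_map (Const :: 'r::comm_ring_1 \<Rightarrow> ('v, 'r) mpoly)"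
  by (simp add: ring_map_def Const_def single_add mult_single)

lemma ring_map_of_bit:
  assumes "(1::'a::comm_ring_1) + 1 = 0"
  shows "ring_map (of_bit :: bit \<Rightarrow> 'a)"
proof -
  have "of_bit (x + y) = (of_bit x + of_bit y :: 'a)" for x y :: bit
    using assms by (cases x; cases y) simp_all
  moreover have "of_bit (x * y) = (of_bit x * of_bit y :: 'a)" for x y :: bit
    by (cases x; cases y) simp_all
  ultimately show ?thesis by (simp add: ring_map_def)
qed


section \<open>The coefficient ring and the dual Steenrod algebra\<close>

datatype M2_gen = Tau | Rho

type_synonym M2 = "(M2_gen, bit) mpoly"

abbreviation tau :: M2 where "tau \<equiv> Var Tau"
abbreviation rho :: M2 where "rho \<equiv> Var Rho"

lemma M2_char_2: "(x::M2) + x = 0"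
  by (rule poly_mapping_eqI) (simp only: lookup_add, simp)

text \<open>
  The generators \<open>\<xi>\<^sub>i\<close> are indexed by \<open>i \<ge> 1\<close>: \<open>Xi_gen i\<close> stands for \<open>\<xi>\<^sub>i\<^sub>+\<^sub>1\<close>.
\<close>

datatype dsa_gen = Tau_gen nat | Xi_gen nat

type_synonym dsa_poly = "(dsa_gen, M2) mpoly"

fun xi_poly :: "nat \<Rightarrow> dsa_poly" where
  "xi_poly 0 = 1"
| "xi_poly (Suc n) = Var (Xi_gen n)"

definition tau_poly :: "nat \<Rightarrow> dsa_poly" where
  "tau_poly n = Var (Tau_gen n)"

definition dsa_relation :: "nat \<Rightarrow> dsa_poly" where
  "dsa_relation n =
     tau_poly n ^ 2 -
     (Const tau * xi_poly (n + 1) + Const rho * tau_poly 0 * xi_poly (n + 1)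
      + Const rho * tau_poly (n + 1))"

text \<open>The ideal is the submodule of the polynomial ring, as a module over itself.\<close>

definition dsa_ideal :: "dsa_poly set" where
  "dsa_ideal = Modules.module.span (*) (range dsa_relation)"

interpretation dsa_poly_module: Modules.module "(*) :: dsa_poly \<Rightarrow> dsa_poly \<Rightarrow> dsa_poly"
  by unfold_locales (simp_all add: algebra_simps)

lemmas dsa_ideal_closed =
  dsa_poly_module.span_zero[of "range dsa_relation", folded dsa_ideal_def]
  dsa_poly_module.span_add[of _ "range dsa_relation", folded dsa_ideal_def]
  dsa_poly_module.span_diff[of _ "range dsa_relation", folded dsa_ideal_def]
  dsa_poly_module.span_neg[of _ "range dsa_relation", folded dsa_ideal_def]
  dsa_poly_module.span_scale[of _ "range dsa_relation", folded dsa_ideal_def]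

lemma dsa_relation_in_ideal: "dsa_relation n \<in> dsa_ideal"
  unfolding dsa_ideal_def by (rule dsa_poly_module.span_base) simp

lemma ring_map_ideal:
  assumes e: "ring_map e" and rel: "\<And>n. e (dsa_relation n) = 0" and "p - q \<in> dsa_ideal"
  shows "e p = e q"
proof -
  have "e x = 0" if "x \<in> dsa_ideal" for x
    using that unfolding dsa_ideal_def
    by (induction rule: dsa_poly_module.span_induct_alt)
      (auto simp: ring_mapD[OF e] rel)
  with assms(3) show ?thesis by (force simp: ring_mapD[OF e])
qed

lemma dsa_ideal_eqI: "p = q \<Longrightarrow> p - q \<in> dsa_ideal"
  by (simp add: dsa_ideal_closed(1))

quotient_type dsa = dsa_poly / "\<lambda>p q. p - q \<in> dsa_ideal"
proof (rule equivpI)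
  show "reflp (\<lambda>p q. p - q \<in> dsa_ideal)"
    by (simp add: reflp_def dsa_ideal_closed(1))
  show "symp (\<lambda>p q. p - q \<in> dsa_ideal)"
    by (rule sympI, drule dsa_ideal_closed(4), simp)
  show "transp (\<lambda>p q. p - q \<in> dsa_ideal)"
    by (rule transpI, drule (1) dsa_ideal_closed(2), simp)
qed

lemma ring_map_id: "ring_map (\<lambda>x. x)"
  by (simp add: ring_map_def)

abbreviation counit_poly :: "dsa_poly \<Rightarrow> M2" where
  "counit_poly \<equiv> poly_eval (\<lambda>m. m) (\<lambda>_. 0)"

lemma counit_poly_relation: "counit_poly (dsa_relation n) = 0"
  by (simp add: dsa_relation_def tau_poly_def ring_map_id
      ring_mapD[OF ring_map_poly_eval[OF ring_map_id]])

instantiation dsa :: comm_ring_1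
begin

lift_definition zero_dsa :: dsa is 0 .
lift_definition one_dsa :: dsa is 1 .
lift_definition plus_dsa :: "dsa \<Rightarrow> dsa \<Rightarrow> dsa" is "(+)"
  by (drule (1) dsa_ideal_closed(2), simp add: algebra_simps)
lift_definition uminus_dsa :: "dsa \<Rightarrow> dsa" is uminus
  by (drule dsa_ideal_closed(4), simp)
lift_definition minus_dsa :: "dsa \<Rightarrow> dsa \<Rightarrow> dsa" is "(-)"
  by (drule (1) dsa_ideal_closed(3), simp add: algebra_simps)
lift_definition times_dsa :: "dsa \<Rightarrow> dsa \<Rightarrow> dsa" is "(*)"
proof -
  fix p p' q q' :: dsa_poly
  assume "p - p' \<in> dsa_ideal" "q - q' \<in> dsa_ideal"
  then have "q * (p - p') + p' * (q - q') \<in> dsa_ideal"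
    by (rule dsa_ideal_closed(2)[OF dsa_ideal_closed(5) dsa_ideal_closed(5)])
  moreover have "q * (p - p') + p' * (q - q') = p * q - p' * q'"
    by (simp add: left_diff_distrib right_diff_distrib mult.commute)
  ultimately show "p * q - p' * q' \<in> dsa_ideal" by simp
qed

instance
proof
  show "(0::dsa) \<noteq> 1"
  proof
    assume "(0::dsa) = 1"
    then have "(0::dsa_poly) - 1 \<in> dsa_ideal"
      by (simp only: zero_dsa.abs_eq one_dsa.abs_eq dsa.abs_eq_iff)
    from ring_map_ideal[OF ring_map_poly_eval[OF ring_map_id] counit_poly_relation this]
    show False by (simp add: ring_mapD[OF ring_map_poly_eval[OF ring_map_id]])
  qed
  fix a b c :: dsa
  show "a * b * c = a * (b * c)"
    by transfer (rule dsa_ideal_eqI, rule mult.assoc)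
  show "a * b = b * a"
    by transfer (rule dsa_ideal_eqI, rule mult.commute)
  show "1 * a = a"
    by transfer (rule dsa_ideal_eqI, rule mult_1)
  show "(a + b) * c = a * c + b * c"
    by transfer (rule dsa_ideal_eqI, rule distrib_right)
  show "a + b + c = a + (b + c)"
    by transfer (rule dsa_ideal_eqI, rule add.assoc)
  show "a + b = b + a"
    by transfer (rule dsa_ideal_eqI, rule add.commute)
  show "0 + a = a"
    by transfer (rule dsa_ideal_eqI, rule add_0)
  show "- a + a = 0"
    by transfer (rule dsa_ideal_eqI, rule left_minus)
  show "a - b = a + - b"
    by transfer (rule dsa_ideal_eqI, rule diff_conv_add_uminus)
qed

end

lemma ring_map_abs_dsa: "ring_map abs_dsa"
  by (simp add: ring_map_def one_dsa.abs_eq plus_dsa.abs_eq times_dsa.abs_eq)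

definition tau_dsa :: "nat \<Rightarrow> dsa" where
  "tau_dsa n = abs_dsa (tau_poly n)"

definition xi_dsa :: "nat \<Rightarrow> dsa" where
  "xi_dsa n = abs_dsa (xi_poly n)"

definition eta_L :: "M2 \<Rightarrow> dsa" where
  "eta_L m = abs_dsa (Const m)"

text \<open>In characteristic 2, \<^const>\<open>of_bool\<close> of the parity is the ring map from the prime field.\<close>

definition eta_R :: "M2 \<Rightarrow> dsa" where
  "eta_R = poly_eval of_bit
     (\<lambda>v. case v of Tau \<Rightarrow> eta_L tau + eta_L rho * tau_dsa 0 | Rho \<Rightarrow> eta_L rho)"

lemma xi_dsa_0 [simp]: "xi_dsa 0 = 1"
  by (simp add: xi_dsa_def one_dsa.abs_eq)

lemma ring_map_eta_L: "ring_map eta_L"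
  using ring_map_abs_dsa ring_map_Const unfolding ring_map_def eta_L_def by metis

lemma dsa_one_plus_one: "(1::dsa) + 1 = 0"
  using ring_mapD(3)[OF ring_map_eta_L, of 1 1] M2_char_2[of 1] ring_mapD(1,2)[OF ring_map_eta_L]
  by simp

lemma dsa_char_2: "(a::dsa) + a = 0"
  using dsa_one_plus_one by (metis distrib_left mult.right_neutral mult_zero_right)

lemma dsa_char_2_left: "(a::dsa) + (a + b) = b"
  by (simp only: add.assoc[symmetric] dsa_char_2 add_0_left)

lemma ring_map_eta_R: "ring_map eta_R"
  unfolding eta_R_def by (intro ring_map_poly_eval ring_map_of_bit dsa_one_plus_one)

lemma eta_R_tau: "eta_R tau = eta_L tau + eta_L rho * tau_dsa 0"
  and eta_R_rho: "eta_R rho = eta_L rho"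
  by (simp_all only: eta_R_def poly_eval_Var[OF ring_map_of_bit[OF dsa_one_plus_one]]
      M2_gen.case)

lemma tau_dsa_square:
  "tau_dsa n ^ 2 =
     eta_L tau * xi_dsa (n + 1) + eta_L rho * tau_dsa 0 * xi_dsa (n + 1)
     + eta_L rho * tau_dsa (n + 1)"
proof -
  have "abs_dsa (dsa_relation n) = 0"
    unfolding zero_dsa.abs_eq dsa.abs_eq_iff using dsa_relation_in_ideal by simp
  then show ?thesis
    by (simp add: dsa_relation_def tau_dsa_def xi_dsa_def eta_L_def ring_mapD[OF ring_map_abs_dsa])
qed

lift_definition counit :: "dsa \<Rightarrow> M2" is counit_poly
  by (rule ring_map_ideal[OF ring_map_poly_eval[OF ring_map_id] counit_poly_relation])


lemmas ring_map_counit_poly = ring_mapD[OF ring_map_poly_eval[OF ring_map_id]]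

lemma ring_map_counit: "ring_map counit"
  unfolding ring_map_def
proof (intro conjI allI)
  show "counit 1 = 1" by transfer (simp add: ring_map_counit_poly)
  show "counit (x + y) = counit x + counit y" for x y
    by transfer (simp add: ring_map_counit_poly)
  show "counit (x * y) = counit x * counit y" for x y
    by transfer (simp add: ring_map_counit_poly)
qed

lemma counit_generators [simp]:
  "counit (eta_L m) = m" "counit (tau_dsa n) = 0" "n \<ge> 1 \<Longrightarrow> counit (xi_dsa n) = 0"
  by (cases n; simp add: eta_L_def tau_dsa_def xi_dsa_def counit.abs_eq tau_poly_def ring_map_id)+

lemma M2_ring_map_eqI:
  fixes h h' :: "M2 \<Rightarrow> 'a::comm_ring_1"
  assumes h: "ring_map h" and h': "ring_map h'" and "h tau = h' tau" "h rho = h' rho"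
  shows "h m = h' m"
proof (rule mpoly_ring_map_eqI[OF h h'])
  show "h (Const c) = h' (Const c)" for c
    by (cases c) (simp_all add: ring_mapD[OF h] ring_mapD[OF h'] ring_mapD[OF ring_map_Const])
  show "h (Var v) = h' (Var v)" for v
    using assms by (cases v) auto
qed

lemma ring_map_comp: "ring_map f \<Longrightarrow> ring_map g \<Longrightarrow> ring_map (\<lambda>x. f (g x))"
  by (simp add: ring_map_def)

lemma counit_eta_R [simp]: "counit (eta_R m) = m"
  by (rule M2_ring_map_eqI[OF ring_map_comp[OF ring_map_counit ring_map_eta_R] ring_map_id])
    (simp_all add: eta_R_tau eta_R_rho ring_mapD[OF ring_map_counit])

fun conj_xi :: "nat \<Rightarrow> dsa" where
  "conj_xi n = (if n = 0 then 1 else \<Sum>i<n. xi_dsa (n - i) ^ (2 ^ i) * conj_xi i)"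

fun conj_tau :: "nat \<Rightarrow> dsa" where
  "conj_tau n = tau_dsa n + (\<Sum>i<n. xi_dsa (n - i) ^ (2 ^ i) * conj_tau i)"

declare conj_xi.simps [simp del] conj_tau.simps [simp del]

abbreviation conj_poly :: "dsa_poly \<Rightarrow> dsa" where
  "conj_poly \<equiv> poly_eval eta_R
     (\<lambda>v. case v of Tau_gen n \<Rightarrow> conj_tau n | Xi_gen n \<Rightarrow> conj_xi (n + 1))"

lemma square_add_char_2:
  assumes "\<And>x::'a::comm_ring_1. x + x = 0"
  shows "(x + y :: 'a)\<^sup>2 = x\<^sup>2 + y\<^sup>2"
proof -
  have "(x + y)\<^sup>2 = x\<^sup>2 + y\<^sup>2 + (x * y + x * y)"
    by (simp only: power2_eq_square distrib_left distrib_right ac_simps)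
  then show ?thesis by (simp only: assms add_0_right)
qed

lemma square_sum_char_2:
  assumes "\<And>x::'a::comm_ring_1. x + x = 0"
  shows "(\<Sum>i\<in>I. f i :: 'a)\<^sup>2 = (\<Sum>i\<in>I. (f i)\<^sup>2)"
proof (induction I rule: infinite_finite_induct)
  case (insert i I)
  then show ?case
    by (simp only: sum.insert[OF insert(1,2)] square_add_char_2[OF assms] insert(3))
qed simp_all

lemma conj_tau_square:
  "conj_tau n ^ 2 = eta_L tau * conj_xi (n + 1) + eta_L rho * conj_tau (n + 1)"
proof (induction n rule: less_induct)
  case (less n)
  let ?T = "eta_L tau" and ?R = "eta_L rho"
  let ?g = "\<lambda>i. xi_dsa (n - i) ^ (2 ^ Suc i)"
  have sq: "(x ^ 2 ^ i)\<^sup>2 = x ^ 2 ^ Suc i" for x :: dsa and i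
    by (simp add: power_mult[symmetric] mult.commute)
  have xi: "conj_xi (n + 1) = xi_dsa (n + 1) + (\<Sum>i<n. ?g i * conj_xi (Suc i))"
    by (subst conj_xi.simps, subst sum.lessThan_Suc_shift[of _ n, unfolded Suc_eq_plus1])
      (simp add: conj_xi.simps[of 0])
  have tau: "conj_tau (n + 1)
      = tau_dsa (n + 1) + xi_dsa (n + 1) * tau_dsa 0 + (\<Sum>i<n. ?g i * conj_tau (Suc i))"
    by (subst conj_tau.simps, subst sum.lessThan_Suc_shift[of _ n, unfolded Suc_eq_plus1])
      (simp add: conj_tau.simps[of 0] add.assoc)
  have "conj_tau n ^ 2 = tau_dsa n ^ 2 + (\<Sum>i<n. ?g i * conj_tau i ^ 2)"
    by (subst conj_tau.simps)
      (simp only: square_add_char_2[OF dsa_char_2] square_sum_char_2[OF dsa_char_2]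
        power_mult_distrib sq)
  also have "(\<Sum>i<n. ?g i * conj_tau i ^ 2)
      = (\<Sum>i<n. ?g i * (?T * conj_xi (Suc i) + ?R * conj_tau (Suc i)))"
    by (intro sum.cong refl) (simp add: less)
  also have "\<dots> = ?T * (\<Sum>i<n. ?g i * conj_xi (Suc i)) + ?R * (\<Sum>i<n. ?g i * conj_tau (Suc i))"
    by (simp add: distrib_left sum.distrib sum_distrib_left mult.left_commute)
  finally show ?case
    unfolding tau_dsa_square xi tau by (simp add: distrib_left ac_simps)
qed

lemma conj_poly_relation: "conj_poly (dsa_relation n) = 0"
proof -
  have xi: "conj_poly (xi_poly (Suc n)) = conj_xi (Suc n)" for n
    by (simp add: ring_map_eta_R)
  have "conj_poly (dsa_relation n)
      = conj_tau n ^ 2 - ((eta_L tau + eta_L rho * tau_dsa 0) * conj_xi (n + 1)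
          + eta_L rho * tau_dsa 0 * conj_xi (n + 1) + eta_L rho * conj_tau (n + 1))"
    by (simp add: dsa_relation_def tau_poly_def ring_mapD[OF ring_map_poly_eval[OF ring_map_eta_R]]
        ring_map_eta_R eta_R_tau eta_R_rho conj_tau.simps[of 0])
  also have "(eta_L tau + eta_L rho * tau_dsa 0) * conj_xi (n + 1)
          + eta_L rho * tau_dsa 0 * conj_xi (n + 1) + eta_L rho * conj_tau (n + 1)
      = eta_L tau * conj_xi (n + 1) + eta_L rho * conj_tau (n + 1)"
    by (simp only: distrib_right add.assoc dsa_char_2_left)
  finally show ?thesis by (simp add: conj_tau_square)
qed

lift_definition conjugation :: "dsa \<Rightarrow> dsa" is conj_poly
  by (rule ring_map_ideal[OF ring_map_poly_eval[OF ring_map_eta_R] conj_poly_relation])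

lemma ring_map_conjugation: "ring_map conjugation"
proof -
  note c = ring_mapD[OF ring_map_poly_eval[OF ring_map_eta_R]]
  have "conjugation 1 = 1" by transfer (rule c)
  moreover have "conjugation (x + y) = conjugation x + conjugation y" for x y by transfer (rule c)
  moreover have "conjugation (x * y) = conjugation x * conjugation y" for x y by transfer (rule c)
  ultimately show ?thesis by (simp add: ring_map_def)
qed

lemma conjugation_eta_L: "conjugation (eta_L m) = eta_R m"
  by (simp add: eta_L_def conjugation.abs_eq ring_map_eta_R)

lemma conjugation_tau: "conjugation (tau_dsa n) = conj_tau n"
  by (simp add: tau_dsa_def tau_poly_def conjugation.abs_eq ring_map_eta_R)

lemma conjugation_xi: "conjugation (xi_dsa n) = conj_xi n"
  by (cases n)
    (simp_all add: xi_dsa_def conjugation.abs_eq ring_map_eta_R conj_xi.simps[of 0]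
      ring_mapD[OF ring_map_poly_eval[OF ring_map_eta_R]])

lemma conjugation_eta_R: "conjugation (eta_R m) = eta_L m"
  by (rule M2_ring_map_eqI[OF ring_map_comp[OF ring_map_conjugation ring_map_eta_R] ring_map_eta_L])
    (simp_all add: eta_R_tau eta_R_rho ring_mapD[OF ring_map_conjugation] conjugation_eta_L
      conjugation_tau conj_tau.simps[of 0] add.assoc dsa_char_2)

section \<open>Modules and tensor products over the coefficient ring\<close>

class M2_module = ab_group_add +
  fixes scaleM2 :: "M2 \<Rightarrow> 'a \<Rightarrow> 'a"  (infixr "*\<^sub>M" 75)
  assumes scaleM2_add_right: "m *\<^sub>M (x + y) = m *\<^sub>M x + m *\<^sub>M y"
    and scaleM2_add_left: "(m + m') *\<^sub>M x = m *\<^sub>M x + m' *\<^sub>M x"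
    and scaleM2_scaleM2: "m *\<^sub>M m' *\<^sub>M x = (m * m') *\<^sub>M x"
    and scaleM2_one [simp]: "1 *\<^sub>M x = x"

interpretation M2_module: Modules.module "scaleM2 :: M2 \<Rightarrow> 'a \<Rightarrow> 'a::M2_module"
  by unfold_locales
    (simp_all add: scaleM2_add_right scaleM2_add_left scaleM2_scaleM2)

class M2_algebra = comm_ring_1 + M2_module +
  assumes scaleM2_mult: "m *\<^sub>M (x * y) = (m *\<^sub>M x) * y"

text \<open>The left module structure; the right one is multiplication through \<^const>\<open>eta_R\<close>.\<close>

instantiation dsa :: M2_algebra
begin

definition scaleM2_dsa :: "M2 \<Rightarrow> dsa \<Rightarrow> dsa" where
  "m *\<^sub>M a = eta_L m * a"

instance
  by standard
    (simp_all add: scaleM2_dsa_def ring_mapD[OF ring_map_eta_L] distrib_left distrib_right mult.assoc)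

end

text \<open>
  \<open>'n dsa_tensor\<close> is the tensor product of the dual Steenrod algebra, as a right module, with the
  left module \<open>'n\<close>. All modules in question are vector spaces over the field with two elements, so
  the tensor product may be formed from the free vector space on the set of pairs instead of the
  free abelian group; a subset closed under addition is then a subgroup.
\<close>

abbreviation pure_pair :: "dsa \<Rightarrow> 'n \<Rightarrow> (dsa \<times> 'n) \<Rightarrow>\<^sub>0 bit" where
  "pure_pair a n \<equiv> Poly_Mapping.single (a, n) 1"

inductive_set tensor_relations :: "((dsa \<times> 'n::M2_module) \<Rightarrow>\<^sub>0 bit) set" where
  zero: "0 \<in> tensor_relations"
| add: "p \<in> tensor_relations \<Longrightarrow> q \<in> tensor_relations \<Longrightarrow> p + q \<in> tensor_relations"
| add_left: "pure_pair (a + b) n - (pure_pair a n + pure_pair b n) \<in> tensor_relations"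
| add_right: "pure_pair a (n + n') - (pure_pair a n + pure_pair a n') \<in> tensor_relations"
| balanced: "pure_pair (a * eta_R m) n - pure_pair a (m *\<^sub>M n) \<in> tensor_relations"

lemma bit_fun_char_2: "(p :: 'k \<Rightarrow>\<^sub>0 bit) + p = 0"
  by (rule poly_mapping_eqI) (simp only: lookup_add, simp)

lemma bit_fun_diff: "(p :: 'k \<Rightarrow>\<^sub>0 bit) - q = p + q"
  by (rule poly_mapping_eqI) (simp add: lookup_add lookup_minus)

quotient_type (overloaded) 'n dsa_tensor = "(dsa \<times> 'n::M2_module) \<Rightarrow>\<^sub>0 bit"
  / "\<lambda>p q. p - q \<in> tensor_relations"
proof (rule equivpI)
  show "reflp (\<lambda>p q::(dsa \<times> 'n) \<Rightarrow>\<^sub>0 bit. p - q \<in> tensor_relations)"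
    by (simp add: reflp_def tensor_relations.zero)
  show "symp (\<lambda>p q::(dsa \<times> 'n) \<Rightarrow>\<^sub>0 bit. p - q \<in> tensor_relations)"
    by (rule sympI) (simp add: bit_fun_diff add.commute)
  show "transp (\<lambda>p q::(dsa \<times> 'n) \<Rightarrow>\<^sub>0 bit. p - q \<in> tensor_relations)"
    by (rule transpI, drule (1) tensor_relations.add) simp
qed

lift_definition pure_tensor :: "dsa \<Rightarrow> 'n::M2_module \<Rightarrow> 'n dsa_tensor"  (infixr "\<otimes>\<^sub>A" 70)
  is pure_pair .

instantiation dsa_tensor :: (M2_module) ab_group_add
begin

lift_definition zero_dsa_tensor :: "'a dsa_tensor" is 0 .
lift_definition plus_dsa_tensor :: "'a dsa_tensor \<Rightarrow> 'a dsa_tensor \<Rightarrow> 'a dsa_tensor" is "(+)"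
  by (drule (1) tensor_relations.add, simp only: add_diff_add[symmetric])
lift_definition uminus_dsa_tensor :: "'a dsa_tensor \<Rightarrow> 'a dsa_tensor" is "\<lambda>p. p" .
lift_definition minus_dsa_tensor :: "'a dsa_tensor \<Rightarrow> 'a dsa_tensor \<Rightarrow> 'a dsa_tensor" is "(+)"
  by (drule (1) tensor_relations.add, simp only: add_diff_add[symmetric])

lemma tensor_eqI: "p = q \<Longrightarrow> p - q \<in> tensor_relations"
  by (simp add: tensor_relations.zero)

instance
proof
  fix a b c :: "'a dsa_tensor"
  show "a + b + c = a + (b + c)"
    by transfer (rule tensor_eqI, rule add.assoc)
  show "a + b = b + a"
    by transfer (rule tensor_eqI, rule add.commute)
  show "0 + a = a"
    by transfer (rule tensor_eqI, rule add_0)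
  show "- a + a = 0"
    by transfer (rule tensor_eqI, rule bit_fun_char_2)
  show "a - b = a + - b"
    by transfer (rule tensor_eqI, rule refl)
qed

end

lemma pure_tensor_add_left: "(a + b) \<otimes>\<^sub>A n = a \<otimes>\<^sub>A n + b \<otimes>\<^sub>A n"
  by transfer (rule tensor_relations.add_left)

lemma pure_tensor_add_right: "a \<otimes>\<^sub>A (n + n') = a \<otimes>\<^sub>A n + a \<otimes>\<^sub>A n'"
  by transfer (rule tensor_relations.add_right)

lemma pure_tensor_balanced: "(a * eta_R m) \<otimes>\<^sub>A n = a \<otimes>\<^sub>A (m *\<^sub>M n)"
  by transfer (rule tensor_relations.balanced)

lemma dsa_tensor_induct [case_names zero add]:
  assumes "P 0" "\<And>t a n. P t \<Longrightarrow> P (t + a \<otimes>\<^sub>A n)"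
  shows "P (t :: 'n::M2_module dsa_tensor)"
proof (induction t rule: dsa_tensor.abs_induct)
  case (1 p)
  show ?case
  proof (induction p rule: poly_mapping_monomial_induct)
    case zero
    with assms(1) show ?case by (simp add: zero_dsa_tensor.abs_eq)
  next
    case (add p k c)
    obtain a n where k: "k = (a, n)" by (cases k)
    from add assms(2)[OF add, of a n] show ?case
      by (cases c)
        (simp_all add: k pure_tensor.abs_eq plus_dsa_tensor.abs_eq)
  qed
qed

text \<open>
  The additive map on the tensor product that sends \<open>a \<otimes> n\<close> to \<open>f a n\<close>; it is meaningful for
  balanced biadditive \<open>f\<close>, where it does not depend on the chosen representative
  (\<open>tensor_lift_pure\<close>, \<open>tensor_lift_add\<close> below). A nonzero coefficient of the representative is 1.
\<close>

definition tensor_lift_rep ::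
  "(dsa \<Rightarrow> 'n \<Rightarrow> 'b::ab_group_add) \<Rightarrow> ((dsa \<times> 'n) \<Rightarrow>\<^sub>0 bit) \<Rightarrow> 'b" where
  "tensor_lift_rep f p = (\<Sum>(a, n)\<in>Poly_Mapping.keys p. f a n)"

definition tensor_lift ::
  "(dsa \<Rightarrow> 'n::M2_module \<Rightarrow> 'b::ab_group_add) \<Rightarrow> 'n dsa_tensor \<Rightarrow> 'b" where
  "tensor_lift f t = tensor_lift_rep f (rep_dsa_tensor t)"

definition balanced_map :: "(dsa \<Rightarrow> 'n::M2_module \<Rightarrow> 'b::ab_group_add) \<Rightarrow> bool" where
  "balanced_map f \<longleftrightarrow>
     (\<forall>a b n. f (a + b) n = f a n + f b n) \<and>
     (\<forall>a n n'. f a (n + n') = f a n + f a n') \<and>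
     (\<forall>a m n. f (a * eta_R m) n = f a (m *\<^sub>M n))"

lemma balanced_map_char_2:
  assumes "balanced_map f"
  shows "f a n + f a n = 0"
proof -
  have "f (a + a) n = f a n + f a n" "f (0 + 0) n = f 0 n + f 0 n"
    using assms unfolding balanced_map_def by blast+
  then show ?thesis by (simp only: dsa_char_2) simp
qed

lemma tensor_lift_rep_pure [simp]: "tensor_lift_rep f (pure_pair a n) = f a n"
  by (simp add: tensor_lift_rep_def)

lemma tensor_lift_rep_add:
  assumes "balanced_map f"
  shows "tensor_lift_rep f (p + q) = tensor_lift_rep f p + tensor_lift_rep f q"
proof -
  let ?c = "\<lambda>p k. if Poly_Mapping.lookup p k = (1::bit) then (case k of (a, n) \<Rightarrow> f a n) else 0"
  let ?S = "Poly_Mapping.keys p \<union> Poly_Mapping.keys q"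
  have eq: "tensor_lift_rep f r = (\<Sum>k\<in>?S. ?c r k)" if "Poly_Mapping.keys r \<subseteq> ?S" for r
    unfolding tensor_lift_rep_def
    by (rule sum.mono_neutral_cong_left) (use that in \<open>auto simp: in_keys_iff\<close>)
  have "?c (p + q) k = ?c p k + ?c q k" for k
    using balanced_map_char_2[OF assms, of "fst k" "snd k"]
    by (cases "Poly_Mapping.lookup p k"; cases "Poly_Mapping.lookup q k")
      (simp_all add: lookup_add split_beta)
  moreover have "Poly_Mapping.keys (p + q) \<subseteq> ?S" by (rule Poly_Mapping.keys_add)
  ultimately show ?thesis by (simp add: eq sum.distrib)
qed

lemma tensor_lift_rep_relation:
  assumes f: "balanced_map f" and "p \<in> tensor_relations"
  shows "tensor_lift_rep f p = 0"
  using assms(2)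
proof induction
  case zero
  show ?case by (simp add: tensor_lift_rep_def)
next
  case (add p q)
  then show ?case by (simp add: tensor_lift_rep_add[OF f])
next
  case (add_left a b n)
  then show ?case
    using f balanced_map_char_2[OF f, of "a + b" n]
    by (simp only: bit_fun_diff tensor_lift_rep_add[OF f] tensor_lift_rep_pure balanced_map_def)
next
  case (add_right a n n')
  then show ?case
    using f balanced_map_char_2[OF f, of a "n + n'"]
    by (simp only: bit_fun_diff tensor_lift_rep_add[OF f] tensor_lift_rep_pure balanced_map_def)
next
  case (balanced a m n)
  then show ?case
    using f balanced_map_char_2[OF f, of a "m *\<^sub>M n"]
    by (simp only: bit_fun_diff tensor_lift_rep_add[OF f] tensor_lift_rep_pure balanced_map_def)
qed

lemma tensor_lift_abs:
  assumes "balanced_map f"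
  shows "tensor_lift f (abs_dsa_tensor p) = tensor_lift_rep f p"
proof -
  let ?r = "rep_dsa_tensor (abs_dsa_tensor p)"
  have "abs_dsa_tensor ?r = abs_dsa_tensor p"
    by (rule Quotient3_abs_rep[OF Quotient3_dsa_tensor])
  then have "?r - p \<in> tensor_relations" by (simp only: dsa_tensor.abs_eq_iff)
  then have "tensor_lift_rep f (?r + p) = 0"
    using tensor_lift_rep_relation[OF assms] by (simp only: bit_fun_diff)
  moreover have "tensor_lift_rep f (p + p) = 0"
    by (simp add: bit_fun_char_2 tensor_lift_rep_def)
  ultimately show ?thesis
    unfolding tensor_lift_def tensor_lift_rep_add[OF assms] by (metis add_right_cancel)
qed

lemma tensor_lift_pure: "balanced_map f \<Longrightarrow> tensor_lift f (a \<otimes>\<^sub>A n) = f a n"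
  by (simp add: pure_tensor.abs_eq tensor_lift_abs)

lemma tensor_lift_add:
  assumes "balanced_map f"
  shows "tensor_lift f (s + t) = tensor_lift f s + tensor_lift f t"
  by (induction s rule: dsa_tensor.abs_induct, induction t rule: dsa_tensor.abs_induct)
    (simp add: plus_dsa_tensor.abs_eq tensor_lift_abs[OF assms] tensor_lift_rep_add[OF assms])

lemma tensor_lift_zero:
  assumes "balanced_map f"
  shows "tensor_lift f 0 = 0"
  using tensor_lift_add[OF assms, of 0 0] by simp

lemma tensor_lift_fun_add:
  "tensor_lift (\<lambda>a n. f a n + g a n) t = tensor_lift f t + tensor_lift g t"
  by (simp add: tensor_lift_def tensor_lift_rep_def split_beta sum.distrib)

lemma dsa_tensor_char_2: "(t :: 'n::M2_module dsa_tensor) + t = 0"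
  by (induction t rule: dsa_tensor.abs_induct)
    (simp add: plus_dsa_tensor.abs_eq zero_dsa_tensor.abs_eq bit_fun_char_2)

instantiation dsa_tensor :: (M2_module) M2_module
begin

definition scaleM2_dsa_tensor :: "M2 \<Rightarrow> 'a dsa_tensor \<Rightarrow> 'a dsa_tensor" where
  "m *\<^sub>M t = tensor_lift (\<lambda>a n. (eta_L m * a) \<otimes>\<^sub>A n) t"

lemma balanced_map_scale:
  "balanced_map (\<lambda>a (n::'a). (eta_L m * a) \<otimes>\<^sub>A n)"
  by (simp add: balanced_map_def distrib_left pure_tensor_add_left pure_tensor_add_right
      mult.assoc[symmetric] pure_tensor_balanced)

lemma scaleM2_pure_tensor: "m *\<^sub>M (a \<otimes>\<^sub>A (n::'a)) = (eta_L m * a) \<otimes>\<^sub>A n"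
  unfolding scaleM2_dsa_tensor_def by (rule tensor_lift_pure[OF balanced_map_scale])

lemma scaleM2_tensor_add: "m *\<^sub>M (s + t :: 'a dsa_tensor) = m *\<^sub>M s + m *\<^sub>M t"
  unfolding scaleM2_dsa_tensor_def by (rule tensor_lift_add[OF balanced_map_scale])

lemma scaleM2_tensor_zero: "m *\<^sub>M (0 :: 'a dsa_tensor) = 0"
  unfolding scaleM2_dsa_tensor_def by (rule tensor_lift_zero[OF balanced_map_scale])

instance
proof
  fix m m' :: M2 and s t :: "'a dsa_tensor"
  show "m *\<^sub>M (s + t) = m *\<^sub>M s + m *\<^sub>M t"
    by (rule scaleM2_tensor_add)
  show "(m + m') *\<^sub>M t = m *\<^sub>M t + m' *\<^sub>M t"
    by (induction t rule: dsa_tensor_induct)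
      (simp_all add: scaleM2_tensor_zero scaleM2_tensor_add scaleM2_pure_tensor
        ring_mapD[OF ring_map_eta_L] distrib_right pure_tensor_add_left)
  show "m *\<^sub>M m' *\<^sub>M t = (m * m') *\<^sub>M t"
    by (induction t rule: dsa_tensor_induct)
      (simp_all add: scaleM2_tensor_zero scaleM2_tensor_add scaleM2_pure_tensor
        ring_mapD[OF ring_map_eta_L] mult.assoc)
  show "1 *\<^sub>M t = t"
    by (induction t rule: dsa_tensor_induct)
      (simp_all add: scaleM2_tensor_zero scaleM2_tensor_add scaleM2_pure_tensor
        ring_mapD[OF ring_map_eta_L])
qed

end

text \<open>
  The tensor product with an algebra is a ring under \<open>(a \<otimes> b) (a' \<otimes> b') = a a' \<otimes> b b'\<close>.
\<close>

instantiation dsa_tensor :: (M2_algebra) comm_ring_1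
begin

definition one_dsa_tensor :: "'a dsa_tensor" where
  "1 = 1 \<otimes>\<^sub>A (1::'a)"

definition times_dsa_tensor :: "'a dsa_tensor \<Rightarrow> 'a dsa_tensor \<Rightarrow> 'a dsa_tensor" where
  "s * t = tensor_lift (\<lambda>a b. tensor_lift (\<lambda>a' b'. (a * a') \<otimes>\<^sub>A (b * b')) t) s"

lemma scaleM2_mult_right: "m *\<^sub>M (x * y) = x * (m *\<^sub>M y)" for x y :: 'a
  using scaleM2_mult[of m y x] by (simp add: mult.commute)

lemma balanced_map_times_inner:
  "balanced_map (\<lambda>a' b'. (a * a') \<otimes>\<^sub>A ((b::'a) * b'))"
  by (simp add: balanced_map_def distrib_left pure_tensor_add_left pure_tensor_add_right
      mult.assoc[symmetric] pure_tensor_balanced scaleM2_mult_right)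

lemma balanced_map_times_outer:
  "balanced_map (\<lambda>a (b::'a). tensor_lift (\<lambda>a' b'. (a * a') \<otimes>\<^sub>A (b * b')) t)"
proof -
  have "(a * eta_R m * a') \<otimes>\<^sub>A (b * b') = (a * a') \<otimes>\<^sub>A (m *\<^sub>M b * b')" for a a' m and b b' :: 'a
  proof -
    have "a * eta_R m * a' = (a * a') * eta_R m" by (simp only: mult_ac)
    then show ?thesis by (simp only: pure_tensor_balanced scaleM2_mult)
  qed
  then show ?thesis
    by (simp add: balanced_map_def distrib_right pure_tensor_add_left pure_tensor_add_right
        tensor_lift_fun_add)
qed

lemma pure_tensor_mult: "(a \<otimes>\<^sub>A b) * (a' \<otimes>\<^sub>A b') = (a * a') \<otimes>\<^sub>A (b * b')" for b b' :: 'a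
  unfolding times_dsa_tensor_def tensor_lift_pure[OF balanced_map_times_outer]
  by (rule tensor_lift_pure[OF balanced_map_times_inner])

lemma tensor_distrib_right: "(s + s') * t = s * t + s' * (t :: 'a dsa_tensor)"
  unfolding times_dsa_tensor_def by (rule tensor_lift_add[OF balanced_map_times_outer])

lemma tensor_distrib_left: "s * (t + t') = s * t + s * (t' :: 'a dsa_tensor)"
  unfolding times_dsa_tensor_def tensor_lift_add[OF balanced_map_times_inner]
  by (rule tensor_lift_fun_add)

lemma tensor_mult_zero: "0 * t = 0" "t * 0 = 0" for t :: "'a dsa_tensor"
  using tensor_distrib_right[of 0 0 t] tensor_distrib_left[of t 0 0] by simp_all

lemmas tensor_mult_simps =
  tensor_mult_zero tensor_distrib_left tensor_distrib_right pure_tensor_mult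

instance
proof
  fix s t u :: "'a dsa_tensor"
  have pure: "(a \<otimes>\<^sub>A b) * (a' \<otimes>\<^sub>A b') * u = (a \<otimes>\<^sub>A b) * ((a' \<otimes>\<^sub>A b') * u)" for a a' and b b' :: 'a
    by (induction u rule: dsa_tensor_induct) (simp_all add: tensor_mult_simps mult.assoc)
  have "(a \<otimes>\<^sub>A b) * t * u = (a \<otimes>\<^sub>A b) * (t * u)" for a and b :: 'a
    by (induction t rule: dsa_tensor_induct)
      (simp_all add: tensor_mult_zero tensor_distrib_left tensor_distrib_right pure)
  then show "s * t * u = s * (t * u)"
    by (induction s rule: dsa_tensor_induct)
      (simp_all add: tensor_mult_zero tensor_distrib_right)
  have "(a \<otimes>\<^sub>A b) * t = t * (a \<otimes>\<^sub>A b)" for a and b :: 'a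
    by (induction t rule: dsa_tensor_induct) (simp_all add: tensor_mult_simps mult.commute)
  then show "s * t = t * s"
    by (induction s rule: dsa_tensor_induct)
      (simp_all add: tensor_mult_zero tensor_distrib_left tensor_distrib_right)
  show "1 * s = s"
    by (induction s rule: dsa_tensor_induct) (simp_all add: one_dsa_tensor_def tensor_mult_simps)
  show "(s + t) * u = s * u + t * u"
    by (rule tensor_distrib_right)
  show "(0 :: 'a dsa_tensor) \<noteq> 1"
  proof
    have bal: "balanced_map (\<lambda>a (b::'a). counit a *\<^sub>M b)"
      by (simp add: balanced_map_def ring_mapD[OF ring_map_counit] scaleM2_add_left
          scaleM2_add_right scaleM2_scaleM2)
    assume "(0 :: 'a dsa_tensor) = 1"
    then have "counit 1 *\<^sub>M (1::'a) = 0"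
      using tensor_lift_pure[OF bal, of 1 1] tensor_lift_zero[OF bal]
      by (simp add: one_dsa_tensor_def)
    then show False by (simp add: ring_mapD[OF ring_map_counit])
  qed
qed

end


section \<open>Comultiplication\<close>

definition comult_xi :: "nat \<Rightarrow> dsa dsa_tensor" where
  "comult_xi n = (\<Sum>i\<le>n. (xi_dsa (n - i) ^ (2 ^ i)) \<otimes>\<^sub>A xi_dsa i)"

definition comult_tau :: "nat \<Rightarrow> dsa dsa_tensor" where
  "comult_tau n = tau_dsa n \<otimes>\<^sub>A 1 + (\<Sum>i\<le>n. (xi_dsa (n - i) ^ (2 ^ i)) \<otimes>\<^sub>A tau_dsa i)"

abbreviation comult_poly :: "dsa_poly \<Rightarrow> dsa dsa_tensor" where
  "comult_poly \<equiv> poly_eval (\<lambda>m. eta_L m \<otimes>\<^sub>A 1)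
     (\<lambda>v. case v of Tau_gen n \<Rightarrow> comult_tau n | Xi_gen n \<Rightarrow> comult_xi (n + 1))"

lemma ring_map_tensor_inl: "ring_map (\<lambda>a. a \<otimes>\<^sub>A (1::'b::M2_algebra))"
  by (simp add: ring_map_def pure_tensor_add_left pure_tensor_mult one_dsa_tensor_def)

lemma ring_map_tensor_inr: "ring_map (\<lambda>b::'b::M2_algebra. 1 \<otimes>\<^sub>A b)"
  by (simp add: ring_map_def pure_tensor_add_right pure_tensor_mult one_dsa_tensor_def)

lemma ring_map_comult_base: "ring_map (\<lambda>m. eta_L m \<otimes>\<^sub>A (1::dsa))"
  by (rule ring_map_comp[OF ring_map_tensor_inl ring_map_eta_L])

lemma pure_tensor_eta_L: "1 \<otimes>\<^sub>A eta_L m = eta_R m \<otimes>\<^sub>A 1"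
  using pure_tensor_balanced[of 1 m "1::dsa"] by (simp add: scaleM2_dsa_def)

lemma comult_tau_square:
  "comult_tau n ^ 2 =
     (eta_L tau \<otimes>\<^sub>A 1) * comult_xi (n + 1) + (eta_L rho \<otimes>\<^sub>A 1) * comult_tau 0 * comult_xi (n + 1)
     + (eta_L rho \<otimes>\<^sub>A 1) * comult_tau (n + 1)"
proof -
  let ?l = "\<lambda>a. a \<otimes>\<^sub>A (1::dsa)" and ?r = "\<lambda>b::dsa. 1 \<otimes>\<^sub>A b"
  let ?t = "?l (eta_L tau)" and ?p = "?l (eta_L rho)" and ?u = "?l (tau_dsa 0)" and ?w = "?r (tau_dsa 0)"
  let ?x = "?l (xi_dsa (n + 1))" and ?v = "?l (tau_dsa (n + 1))"
  define g where "g i = ?l (xi_dsa (n - i) ^ 2 ^ Suc i)" for i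
  define S1 where "S1 = (\<Sum>i\<le>n. g i * ?r (xi_dsa (Suc i)))"
  define S2 where "S2 = (\<Sum>i\<le>n. g i * ?r (tau_dsa (Suc i)))"
  have lr: "a \<otimes>\<^sub>A b = ?l a * ?r b" for a b :: dsa
    by (simp add: pure_tensor_mult)
  have xi: "comult_xi (n + 1) = ?x + S1"
    unfolding comult_xi_def Suc_eq_plus1[symmetric] sum.atMost_Suc_shift S1_def g_def
    by (simp add: pure_tensor_mult)
  have tau: "comult_tau (n + 1) = ?v + ?x * ?w + S2"
    unfolding comult_tau_def Suc_eq_plus1[symmetric] sum.atMost_Suc_shift S2_def g_def
    by (simp add: pure_tensor_mult add.assoc)
  have tau0: "comult_tau 0 = ?u + ?w"
    by (simp add: comult_tau_def)
  have sqr: "?r (tau_dsa i ^ 2)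
      = (?t + ?p * ?u) * ?r (xi_dsa (Suc i)) + ?p * ?w * ?r (xi_dsa (Suc i)) + ?p * ?r (tau_dsa (Suc i))" for i
  proof -
    have "?r (eta_L tau) = ?t + ?p * ?u" "?r (eta_L rho) = ?p"
      by (simp_all add: pure_tensor_eta_L eta_R_tau eta_R_rho pure_tensor_add_left pure_tensor_mult)
    then show ?thesis
      by (simp only: tau_dsa_square Suc_eq_plus1 ring_mapD(3,4)[OF ring_map_tensor_inr])
  qed
  have sql: "?l (tau_dsa n ^ 2) = ?t * ?x + ?p * ?u * ?x + ?p * ?v"
    by (simp only: tau_dsa_square ring_mapD(3,4)[OF ring_map_tensor_inl])
  have sq: "(a \<otimes>\<^sub>A b)\<^sup>2 = a\<^sup>2 \<otimes>\<^sub>A b\<^sup>2" for a b :: dsa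
    by (simp add: power2_eq_square pure_tensor_mult)
  have sqi: "((xi_dsa (n - i) ^ 2 ^ i) \<otimes>\<^sub>A tau_dsa i)\<^sup>2 = g i * ?r (tau_dsa i ^ 2)" for i
    by (simp add: sq g_def pure_tensor_mult power_mult[symmetric] mult.commute)
  have "comult_tau n ^ 2 = ?l (tau_dsa n ^ 2) + (\<Sum>i\<le>n. g i * ?r (tau_dsa i ^ 2))"
    unfolding comult_tau_def square_add_char_2[OF dsa_tensor_char_2]
      square_sum_char_2[OF dsa_tensor_char_2] sqi by (simp add: sq)
  also have "(\<Sum>i\<le>n. g i * ?r (tau_dsa i ^ 2)) = (?t + ?p * ?u + ?p * ?w) * S1 + ?p * S2"
    unfolding S1_def S2_def sum_distrib_left sum.distrib[symmetric] sqr
    by (rule sum.cong[OF refl]) (simp only: distrib_left distrib_right ac_simps)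
  finally have 1: "comult_tau n ^ 2
      = ?t * ?x + ?p * ?u * ?x + ?p * ?v + ((?t + ?p * ?u + ?p * ?w) * S1 + ?p * S2)"
    unfolding sql .
  have "?t * (x + s) + ?p * (?u + ?w) * (x + s) + ?p * (v + x * ?w + s')
      = ?t * x + ?p * ?u * x + ?p * v + ((?t + ?p * ?u + ?p * ?w) * s + ?p * s')
        + (?p * ?w * x + ?p * ?w * x)" for x v s s'
    by (simp only: distrib_left distrib_right ac_simps)
  then show ?thesis
    unfolding xi tau tau0 1 by (simp only: dsa_tensor_char_2 add_0_right)
qed

lemma comult_poly_relation: "comult_poly (dsa_relation n) = 0"
  using comult_tau_square[of n]
  by (simp add: dsa_relation_def tau_poly_def ring_map_comult_base
      ring_mapD[OF ring_map_poly_eval[OF ring_map_comult_base]])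

lift_definition comult :: "dsa \<Rightarrow> dsa dsa_tensor" is comult_poly
  by (rule ring_map_ideal[OF ring_map_poly_eval[OF ring_map_comult_base] comult_poly_relation])


lemma comult_generators:
  "comult (eta_L m) = eta_L m \<otimes>\<^sub>A 1"
  "comult (tau_dsa n) = comult_tau n"
  "comult (xi_dsa n) = comult_xi n"
proof -
  show "comult (eta_L m) = eta_L m \<otimes>\<^sub>A 1"
    by (simp add: eta_L_def[of m] comult.abs_eq ring_map_comult_base)
  show "comult (tau_dsa n) = comult_tau n"
    by (simp add: tau_dsa_def tau_poly_def comult.abs_eq ring_map_comult_base)
  have "comult_poly (xi_poly n) = comult_xi n"
    by (cases n)
      (simp_all add: ring_map_comult_base comult_xi_def[of 0] one_dsa_tensor_def[symmetric]
        ring_mapD[OF ring_map_poly_eval[OF ring_map_comult_base]])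
  then show "comult (xi_dsa n) = comult_xi n"
    by (simp only: xi_dsa_def comult.abs_eq)
qed


section \<open>Gradings\<close>

text \<open>Bidegrees are homological.\<close>

definition M2_gen_degree :: "M2_gen \<Rightarrow> int \<times> int" where
  "M2_gen_degree v = (case v of Tau \<Rightarrow> (0, -1) | Rho \<Rightarrow> (-1, -1))"

definition dsa_gen_degree :: "dsa_gen \<Rightarrow> int \<times> int" where
  "dsa_gen_degree v =
     (case v of
        Tau_gen i \<Rightarrow> (2 ^ (i + 1) - 1, 2 ^ i - 1)
      | Xi_gen i \<Rightarrow> (2 ^ (i + 2) - 2, 2 ^ (i + 1) - 1))"

definition M2_piece :: "int \<times> int \<Rightarrow> M2 set" where
  "M2_piece d = {p. \<forall>k\<in>Poly_Mapping.keys p. monom_degree M2_gen_degree k = d}"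

definition dsa_piece :: "int \<times> int \<Rightarrow> dsa set" where
  "dsa_piece d = abs_dsa `
     {p. \<forall>k\<in>Poly_Mapping.keys p. \<forall>l\<in>Poly_Mapping.keys (Poly_Mapping.lookup p k).
           monom_degree dsa_gen_degree k + monom_degree M2_gen_degree l = d}"

inductive_set tensor_piece :: "(int \<times> int \<Rightarrow> 'n::M2_module set) \<Rightarrow> int \<times> int \<Rightarrow> 'n dsa_tensor set"
  for G d where
  zero: "0 \<in> tensor_piece G d"
| add: "t \<in> tensor_piece G d \<Longrightarrow> a \<in> dsa_piece e \<Longrightarrow> n \<in> G e' \<Longrightarrow> e + e' = d
    \<Longrightarrow> t + a \<otimes>\<^sub>A n \<in> tensor_piece G d"

definition M2_bigrading :: "(int \<times> int \<Rightarrow> 'n::M2_module set) \<Rightarrow> bool" where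
  "M2_bigrading G \<longleftrightarrow>
     (\<forall>d. 0 \<in> G d \<and> (\<forall>x\<in>G d. \<forall>y\<in>G d. x - y \<in> G d)) \<and>
     (\<forall>d e. \<forall>m\<in>M2_piece d. \<forall>x\<in>G e. m *\<^sub>M x \<in> G (d + e)) \<and>
     (\<forall>x. \<exists>!f. finite {d. f d \<noteq> 0} \<and> (\<forall>d. f d \<in> G d) \<and> x = (\<Sum>d | f d \<noteq> 0. f d))"


section \<open>The Steenrod algebra, comodules and modules\<close>

definition steenrod_piece :: "int \<times> int \<Rightarrow> (dsa \<Rightarrow> M2) set" where
  "steenrod_piece e =
     {\<phi>. module_hom scaleM2 (*) \<phi> \<and> (\<forall>d. \<forall>a\<in>dsa_piece d. \<phi> a \<in> M2_piece (d + e))}"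

text \<open>
  The bigraded linear maps are the finite sums of homogeneous ones. The product sends \<open>a\<close> to
  the sum of \<open>\<phi> (a' * eta_R (\<psi> a''))\<close>.
\<close>

definition steenrod_algebra :: "(dsa \<Rightarrow> M2) ring" where
  "steenrod_algebra =
     \<lparr>carrier = {(\<lambda>a. \<Sum>e\<in>E. f e a) | E f. finite E \<and> (\<forall>e\<in>E. f e \<in> steenrod_piece e)},
      mult = (\<lambda>\<phi> \<psi> a. tensor_lift (\<lambda>a' a''. \<phi> (a' * eta_R (\<psi> a''))) (comult a)),
      one = counit,
      zero = (\<lambda>a. 0),
      add = (\<lambda>\<phi> \<psi> a. \<phi> a + \<psi> a)\<rparr>"

text \<open>
  Coassociativity is stated in the right-nested triple tensor product; its left-hand side is
  \<open>\<Delta> \<otimes> id\<close> followed by the associativity isomorphism, its right-hand side \<open>id \<otimes> \<psi>\<close>.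
\<close>

definition left_comodule :: "('n::M2_module \<Rightarrow> 'n dsa_tensor) \<Rightarrow> bool" where
  "left_comodule \<psi> \<longleftrightarrow>
     module_hom scaleM2 scaleM2 \<psi> \<and>
     (\<forall>n. tensor_lift (\<lambda>a x. tensor_lift (\<lambda>a' a''. a' \<otimes>\<^sub>A (a'' \<otimes>\<^sub>A x)) (comult a)) (\<psi> n)
        = tensor_lift (\<lambda>a x. a \<otimes>\<^sub>A \<psi> x) (\<psi> n)) \<and>
     (\<forall>n. tensor_lift (\<lambda>a x. counit a *\<^sub>M x) (\<psi> n) = n)"

text \<open>A left module, over a not necessarily commutative ring, on the additive group of a type.\<close>

locale left_module = ring R for R (structure) +
  fixes act :: "'a \<Rightarrow> 'n::ab_group_add \<Rightarrow> 'n"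
  assumes act_add_right: "r \<in> carrier R \<Longrightarrow> act r (x + y) = act r x + act r y"
    and act_add_left: "r \<in> carrier R \<Longrightarrow> s \<in> carrier R \<Longrightarrow> act (r \<oplus> s) x = act r x + act s x"
    and act_mult: "r \<in> carrier R \<Longrightarrow> s \<in> carrier R \<Longrightarrow> act (r \<otimes> s) x = act r (act s x)"
    and act_one: "act \<one> x = x"

lemma balanced_map_comodule_act:
  assumes "module_hom scaleM2 (*) (\<phi> :: dsa \<Rightarrow> M2)"
  shows "balanced_map (\<lambda>a (x::'n::M2_module). (\<phi> \<circ> conjugation) a *\<^sub>M x)"
proof -
  interpret module_hom scaleM2 "(*)" \<phi> by fact
  show ?thesis
    unfolding balanced_map_def o_def
  proof (intro conjI allI)
    fix a b :: dsa and m :: M2 and x y :: 'n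
    show "\<phi> (conjugation (a + b)) *\<^sub>M x = \<phi> (conjugation a) *\<^sub>M x + \<phi> (conjugation b) *\<^sub>M x"
      by (simp only: ring_mapD(3)[OF ring_map_conjugation] add scaleM2_add_left)
    show "\<phi> (conjugation a) *\<^sub>M (x + y) = \<phi> (conjugation a) *\<^sub>M x + \<phi> (conjugation a) *\<^sub>M y"
      by (rule scaleM2_add_right)
    have "conjugation (a * eta_R m) = m *\<^sub>M conjugation a"
      by (simp only: ring_mapD(4)[OF ring_map_conjugation] conjugation_eta_R scaleM2_dsa_def
          mult.commute)
    then show "\<phi> (conjugation (a * eta_R m)) *\<^sub>M x = \<phi> (conjugation a) *\<^sub>M m *\<^sub>M x"
      by (simp only: scale scaleM2_scaleM2 mult.commute)
  qed
qed

text \<open>\<open>\<phi> c \<otimes> id\<close> applied to \<open>\<psi> n\<close>, followed by the identification of \<open>m \<otimes> x\<close> with \<open>m *\<^sub>M x\<close>.\<close>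

definition comodule_act ::
  "('n::M2_module \<Rightarrow> 'n dsa_tensor) \<Rightarrow> (dsa \<Rightarrow> M2) \<Rightarrow> 'n \<Rightarrow> 'n" where
  "comodule_act \<psi> \<phi> n = tensor_lift (\<lambda>a x. (\<phi> \<circ> conjugation) a *\<^sub>M x) (\<psi> n)"

end

theory Submission
  imports Defs
begin

text \<open>
  Associativity of the action comes down to the Hopf algebroid identities: coassociativity and
  \<open>\<Delta> (c a) = \<Sum> c a'' \<otimes> c a'\<close>. All maps involved are ring maps, so it suffices to check the
  identities on generators. There \<open>\<Delta>\<close> and \<open>c\<close> are expressed by one twisted convolution
  \<open>(x * y)\<^sub>n = \<Sum>\<^sub>i x\<^sub>n\<^sub>-\<^sub>i\<^bsup>2^i\<^esup> y\<^sub>i\<close>, which is associative and unital in characteristic 2: with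
  \<open>\<xi>'\<close>, \<open>\<xi>''\<close> the sequence \<open>\<xi>\<close> in the two tensor factors,
  \<open>\<Delta> \<xi> = \<xi>' * \<xi>''\<close>, \<open>\<Delta> \<tau> = \<tau>' + \<xi>' * \<tau>''\<close>, \<open>\<xi> * c \<xi> = 1\<close>, and \<open>\<xi> * c \<tau> = \<tau>\<close>.
\<close>

section \<open>Twisted convolution\<close>

text \<open>The left and right units differ on \<tau>, so every map on a tensor product has to be
  shown balanced: \<open>eta_R m\<close> on the left factor must match the action of
  \<open>m\<close> on the right factor. For expressions in \<Delta> this rests on
  \<open>comult (eta_R m) = 1 \<otimes> eta_R m\<close>.

  Without c the formula would compose in the wrong order. In \<phi> \<cdot> (\<chi> \<cdot> n) the
  map \<chi> meets the first tensor factor of the iterated coaction and \<phi> the second, while the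
  product \<phi>\<chi> evaluates \<phi> on the first and \<chi> on the second. The conjugation
  exchanges the two factors, and it also exchanges the two units, which makes
  \<open>\<phi> c\<close> right linear.

  Finally, elements of the algebra are finite sums of homogeneous maps. Closure under the product
  therefore needs \<Delta> and \<open>eta_R\<close> to preserve bidegrees, and the unit needs the
  same of the counit; that c preserves them makes the action compatible with any bigrading that the
  coaction respects.\<close>

text \<open>
  In characteristic 2, these are the coefficients of the composite \<open>g (f t)\<close> of the additive power
  series \<open>f t = \<Sum> x\<^sub>n t\<^bsup>2^n\<^esup>\<close> and \<open>g t = \<Sum> y\<^sub>n t\<^bsup>2^n\<^esup>\<close>, whence associativity.
\<close>

definition tconv :: "(nat \<Rightarrow> 'a::comm_ring_1) \<Rightarrow> (nat \<Rightarrow> 'a) \<Rightarrow> nat \<Rightarrow> 'a" where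
  "tconv x y n = (\<Sum>i\<le>n. x (n - i) ^ (2 ^ i) * y i)"

definition tconv_unit :: "nat \<Rightarrow> 'a::comm_ring_1" where
  "tconv_unit n = (if n = 0 then 1 else 0)"

text \<open>Iterated Frobenius, the operation that \<open>tconv\<close> applies to its first
  argument.\<close>

lemma power_2_power_sum_char_2:
  assumes "\<And>x::'a::comm_ring_1. x + x = 0"
  shows "(\<Sum>j\<in>J. f j :: 'a) ^ (2 ^ i) = (\<Sum>j\<in>J. f j ^ (2 ^ i))"
proof (induction i)
  case (Suc i)
  then show ?case
    by (simp add: power_mult mult.commute[of 2] square_sum_char_2[OF assms])
qed simp

lemma tconv_assoc:
  assumes "\<And>x::'a::comm_ring_1. x + x = 0"
  shows "tconv (tconv x y) z = tconv x (tconv y (z :: nat \<Rightarrow> 'a))"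
proof
  fix n
  have "tconv (tconv x y) z n
      = (\<Sum>i\<le>n. \<Sum>j\<le>n - i. x (n - i - j) ^ (2 ^ (i + j)) * y j ^ (2 ^ i) * z i)"
    unfolding tconv_def
    by (simp add: power_2_power_sum_char_2[OF assms] power_mult_distrib sum_distrib_left
        power_mult[symmetric] power_add mult_ac)
  also have "\<dots> = (\<Sum>(i, j)\<in>(SIGMA i:{..n}. {..n - i}).
      x (n - i - j) ^ (2 ^ (i + j)) * y j ^ (2 ^ i) * z i)"
    by (rule sum.Sigma) auto
  also have "\<dots> = (\<Sum>(m, i)\<in>(SIGMA m:{..n}. {..m}).
      x (n - m) ^ (2 ^ m) * y (m - i) ^ (2 ^ i) * z i)"
    \<comment> \<open>Here \<open>m = i + j\<close> becomes the outer summation index of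
      \<open>tconv x (tconv y z)\<close>, so \<open>y\<close> gets the index
      \<open>m - i\<close>.\<close>
    by (rule sum.reindex_bij_witness[where i = "\<lambda>(m, i). (i, m - i)" and j = "\<lambda>(i, j). (i + j, i)"])
      auto
  also have "\<dots> = (\<Sum>m\<le>n. \<Sum>i\<le>m. x (n - m) ^ (2 ^ m) * y (m - i) ^ (2 ^ i) * z i)"
    by (rule sum.Sigma[symmetric]) auto
  also have "\<dots> = tconv x (tconv y z) n"
    unfolding tconv_def by (simp add: sum_distrib_left mult.assoc)
  finally show "tconv (tconv x y) z n = tconv x (tconv y z) n" .
qed

lemma tconv_unit_left: "tconv tconv_unit y = y"
proof
  fix n
  have "tconv tconv_unit y n = (\<Sum>i\<le>n. if i = n then y i else 0)"
    \<comment> \<open>The exponent \<open>2 ^ i\<close> is positive, so the zero coefficients of the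
      unit stay zero under the power.\<close>
    unfolding tconv_def by (rule sum.cong) (auto simp: tconv_unit_def power_0_left)
  then show "tconv tconv_unit y n = y n" by simp
qed

lemma tconv_unit_right: "tconv x tconv_unit = x"
proof
  fix n
  have "tconv x tconv_unit n = (\<Sum>i\<le>n. if i = 0 then x (n - i) else 0)"
    unfolding tconv_def by (rule sum.cong) (auto simp: tconv_unit_def)
  then show "tconv x tconv_unit n = x n" by simp
qed

lemma tconv_zero_right: "tconv x (\<lambda>n. 0) = (\<lambda>n. 0)"
  by (simp add: tconv_def fun_eq_iff)

lemma tconv_add_right: "tconv x (\<lambda>n. y n + z n) = (\<lambda>n. tconv x y n + tconv x z n)"
  by (simp add: tconv_def fun_eq_iff distrib_left sum.distrib)

lemma tconv_split: "tconv x y n = (\<Sum>i<n. x (n - i) ^ (2 ^ i) * y i) + x 0 ^ (2 ^ n) * y n"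
  by (simp add: tconv_def lessThan_Suc_atMost[symmetric])

text \<open>Since \<open>x 0 = 1\<close>, the summand \<open>i = n\<close> is the
  \<open>n\<close>-th value itself and all others involve earlier values. This takes the place of
  inverses: a sequence is identified by the equation it satisfies after convolution with \<Delta>
  \<xi>.\<close>

lemma tconv_left_cancel:
  assumes "x 0 = 1" and eq: "tconv x y = tconv x z"
  shows "y = z"
proof
  fix n
  show "y n = z n"
  proof (induction n rule: less_induct)
    case (less n)
    then have "(\<Sum>i<n. x (n - i) ^ (2 ^ i) * y i) = (\<Sum>i<n. x (n - i) ^ (2 ^ i) * z i)"
      by (intro sum.cong) auto
    with fun_cong[OF eq, of n] show ?case
      by (simp add: tconv_split assms(1))
  qed
qed

lemma ring_map_tconv:
  "ring_map h \<Longrightarrow> h (tconv x y n) = tconv (\<lambda>n. h (x n)) (\<lambda>n. h (y n)) n"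
  by (simp add: tconv_def ring_map_sum ring_mapD)


section \<open>Ring maps out of the dual Steenrod algebra and its tensor products\<close>

lemma dsa_ring_map_eqI:
  fixes h h' :: "dsa \<Rightarrow> 'a::comm_ring_1"
  assumes h: "ring_map h" and h': "ring_map h'"
    and eta: "\<And>m. h (eta_L m) = h' (eta_L m)"
    and tau: "\<And>n. h (tau_dsa n) = h' (tau_dsa n)"
    and xi: "\<And>n. h (xi_dsa n) = h' (xi_dsa n)"
  shows "h a = h' a"
proof (induction a rule: dsa.abs_induct)
  case (1 p)
  show ?case
  proof (rule mpoly_ring_map_eqI[OF ring_map_comp[OF h ring_map_abs_dsa]
        ring_map_comp[OF h' ring_map_abs_dsa]])
    show "h (abs_dsa (Const c)) = h' (abs_dsa (Const c))" for c
      using eta by (simp add: eta_L_def)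
    show "h (abs_dsa (Var v)) = h' (abs_dsa (Var v))" for v
    proof (cases v)
      case (Tau_gen n)
      then show ?thesis using tau[of n] by (simp add: tau_dsa_def tau_poly_def)
    next
      case (Xi_gen n)
      then show ?thesis using xi[of "Suc n"] by (simp add: xi_dsa_def)
    qed
  qed
qed

lemma ring_map_comult: "ring_map comult"
proof -
  note c = ring_mapD[OF ring_map_poly_eval[OF ring_map_comult_base]]
  have "comult 1 = 1" by transfer (rule c)
  moreover have "comult (x + y) = comult x + comult y" for x y by transfer (rule c)
  moreover have "comult (x * y) = comult x * comult y" for x y by transfer (rule c)
  ultimately show ?thesis by (simp add: ring_map_def)
qed

lemma balanced_mapD:
  assumes "balanced_map f"
  shows "f (a + b) n = f a n + f b n" "f a (n + n') = f a n + f a n'"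
    "f (a * eta_R m) n = f a (m *\<^sub>M n)"
  using assms unfolding balanced_map_def by blast+

text \<open>Both sides are additive and agree on pure tensors. This is how an outer map is moved
  under a Sweedler sum.\<close>

lemma additive_tensor_lift:
  assumes h: "\<And>x y. h (x + y) = h x + h y" and f: "balanced_map f"
  shows "h (tensor_lift f t) = tensor_lift (\<lambda>a n. h (f a n)) t"
proof -
  have bal: "balanced_map (\<lambda>a n. h (f a n))"
    using f by (simp add: balanced_map_def h)
  have h0: "h 0 = 0" using h[of 0 0] by simp
  show ?thesis
    by (induction t rule: dsa_tensor_induct)
      (simp_all add: h h0 tensor_lift_zero tensor_lift_add tensor_lift_pure f bal)
qed

text \<open>The tensor product of commutative algebras is a pushout of rings: \<open>f\<close> and
  \<open>g\<close> glue once they agree on scalars, seen through \<open>eta_R\<close> on the left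
  factor. Composed with \<open>comult\<close>, the glued map is determined by its values on
  generators.\<close>

lemma ring_map_tensor_lift:
  fixes f :: "dsa \<Rightarrow> 'a::comm_ring_1" and g :: "'n::M2_algebra \<Rightarrow> 'a"
  assumes f: "ring_map f" and g: "ring_map g"
    and fg: "\<And>m. f (eta_R m) = g (m *\<^sub>M 1)"
  shows "balanced_map (\<lambda>a n. f a * g n)" "ring_map (tensor_lift (\<lambda>a n. f a * g n))"
proof -
  have scale: "g (m *\<^sub>M n) = f (eta_R m) * g n" for m n
    using scaleM2_mult[of m 1 n] ring_mapD(4)[OF g, of "m *\<^sub>M 1" n] by (simp add: fg)
  show bal: "balanced_map (\<lambda>a n. f a * g n)"
    by (simp add: balanced_map_def ring_mapD[OF f] ring_mapD[OF g] distrib_left distrib_right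
        scale mult.assoc)
  let ?h = "tensor_lift (\<lambda>a n. f a * g n)"
  note lift = tensor_lift_add[OF bal] tensor_lift_zero[OF bal] tensor_lift_pure[OF bal]
  have 1: "?h ((a \<otimes>\<^sub>A n) * t) = ?h (a \<otimes>\<^sub>A n) * ?h t" for a n t
    by (induction t rule: dsa_tensor_induct)
      (simp_all add: lift tensor_mult_simps distrib_left ring_mapD[OF f] ring_mapD[OF g] mult_ac)
  have "?h (s * t) = ?h s * ?h t" for s t
    by (induction s rule: dsa_tensor_induct)
      (simp_all add: lift(1,2) tensor_mult_zero tensor_distrib_right distrib_right 1)
  moreover have "?h 1 = 1"
    by (simp add: one_dsa_tensor_def lift ring_mapD[OF f] ring_mapD[OF g])
  ultimately show "ring_map ?h" by (simp add: ring_map_def lift)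
qed

lemma scaleM2_one_dsa: "m *\<^sub>M (1::dsa) = eta_L m"
  by (simp add: scaleM2_dsa_def)

lemma scaleM2_one_tensor: "m *\<^sub>M (1 :: 'n::M2_algebra dsa_tensor) = eta_L m \<otimes>\<^sub>A 1"
  by (simp add: one_dsa_tensor_def scaleM2_pure_tensor)

text \<open>This makes the triple tensor product a ring, so that coassociativity can be compared on
  generators.\<close>

instance dsa_tensor :: (M2_algebra) M2_algebra
proof
  fix m :: M2 and x y :: "'a dsa_tensor"
  have "m *\<^sub>M t = (eta_L m \<otimes>\<^sub>A 1) * t" for t :: "'a dsa_tensor"
    by (induction t rule: dsa_tensor_induct)
      (simp_all add: scaleM2_tensor_zero scaleM2_tensor_add scaleM2_pure_tensor tensor_mult_simps)
  then show "m *\<^sub>M (x * y) = (m *\<^sub>M x) * y" by (simp only: mult.assoc)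
qed

lemma comult_xi_tconv:
  "comult (xi_dsa n) = tconv (\<lambda>n. xi_dsa n \<otimes>\<^sub>A 1) (\<lambda>n. 1 \<otimes>\<^sub>A xi_dsa n) n"
  by (simp add: comult_generators comult_xi_def tconv_def pure_tensor_mult
      ring_mapD(7)[OF ring_map_tensor_inl, symmetric])

lemma comult_tau_tconv:
  "comult (tau_dsa n)
    = tau_dsa n \<otimes>\<^sub>A 1 + tconv (\<lambda>n. xi_dsa n \<otimes>\<^sub>A 1) (\<lambda>n. 1 \<otimes>\<^sub>A tau_dsa n) n"
  by (simp add: comult_generators comult_tau_def tconv_def pure_tensor_mult
      ring_mapD(7)[OF ring_map_tensor_inl, symmetric])

text \<open>Right linearity of \<Delta>: the right unit ends up in the last factor.\<close>

lemma comult_eta_R: "comult (eta_R m) = 1 \<otimes>\<^sub>A eta_R m"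
proof (rule M2_ring_map_eqI[OF ring_map_comp[OF ring_map_comult ring_map_eta_R]
      ring_map_comp[OF ring_map_tensor_inr ring_map_eta_R]])
  note c = ring_mapD[OF ring_map_comult] comult_generators(1)
  have rho: "1 \<otimes>\<^sub>A eta_L rho = eta_L rho \<otimes>\<^sub>A (1::dsa)"
    by (simp add: pure_tensor_eta_L eta_R_rho)
  then show "comult (eta_R rho) = 1 \<otimes>\<^sub>A eta_R rho"
    by (simp add: eta_R_rho c)
  have "comult (eta_R tau) = eta_R tau \<otimes>\<^sub>A 1 + (eta_L rho \<otimes>\<^sub>A 1) * (1 \<otimes>\<^sub>A tau_dsa 0)"
    by (simp add: eta_R_tau c comult_tau_tconv tconv_def pure_tensor_add_left pure_tensor_mult
        tensor_distrib_left add.assoc)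
  \<comment> \<open>Balancing carries \<open>eta_R tau\<close> across the tensor sign as
    \<open>eta_L tau\<close>; with the remaining term in \<rho> it reassembles
    \<open>eta_R tau\<close> in the second factor.\<close>
  also have "eta_R tau \<otimes>\<^sub>A (1::dsa) = 1 \<otimes>\<^sub>A eta_L tau"
    by (simp add: pure_tensor_eta_L)
  finally show "comult (eta_R tau) = 1 \<otimes>\<^sub>A eta_R tau"
    by (simp only: rho[symmetric]) (simp add: eta_R_tau pure_tensor_add_right pure_tensor_mult)
qed


section \<open>The Hopf algebroid axioms\<close>

lemma balanced_map_counit: "balanced_map (\<lambda>a (x::'n::M2_module). counit a *\<^sub>M x)"
  by (simp add: balanced_map_def ring_mapD[OF ring_map_counit] scaleM2_add_left
      scaleM2_add_right scaleM2_scaleM2)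

text \<open>The counit turns \<xi> into the unit of twisted convolution. The map \<open>h\<close>
  will be \<open>eta_L\<close> or \<open>eta_R\<close>, depending on the factor to which the counit
  is applied.\<close>

lemma tconv_counit_xi:
  assumes "ring_map h"
  shows "(\<lambda>n. h (counit (xi_dsa n))) = tconv_unit"
proof
  show "h (counit (xi_dsa n)) = tconv_unit n" for n
    by (cases n) (simp_all add: tconv_unit_def ring_mapD[OF assms] ring_mapD[OF ring_map_counit])
qed

text \<open>Writing the action as multiplication by \<open>eta_L (counit a)\<close> makes the left
  side a ring map in \<open>a\<close>. On generators \<xi>' becomes the convolution unit and \<tau>'
  vanishes, so that \<xi>'' and \<tau>'' survive.\<close>

lemma comult_counit_left: "tensor_lift (\<lambda>a x. counit a *\<^sub>M x) (comult a) = a"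
proof -
  let ?h = "tensor_lift (\<lambda>a x. eta_L (counit a) * x)"
  have r: "ring_map (\<lambda>a. eta_L (counit a))" by (rule ring_map_comp[OF ring_map_eta_L ring_map_counit])
  note L = ring_map_tensor_lift[OF r ring_map_id, unfolded scaleM2_one_dsa counit_eta_R, OF refl]
  note pure = tensor_lift_pure[OF L(1)] and h = ring_mapD[OF L(2)]
  have "?h (comult a) = a"
  proof (rule dsa_ring_map_eqI[OF ring_map_comp[OF L(2) ring_map_comult] ring_map_id])
    show "?h (comult (eta_L m)) = eta_L m" for m
      by (simp add: comult_generators pure)
    show "?h (comult (xi_dsa n)) = xi_dsa n" for n
      by (simp add: comult_xi_tconv ring_map_tconv[OF L(2)] pure ring_mapD[OF r]
          tconv_counit_xi[OF ring_map_eta_L] tconv_unit_left)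
    show "?h (comult (tau_dsa n)) = tau_dsa n" for n
      by (simp add: comult_tau_tconv h ring_map_tconv[OF L(2)] pure ring_mapD[OF r]
          tconv_counit_xi[OF ring_map_eta_L] tconv_unit_left ring_mapD[OF ring_map_eta_L])
  qed
  then show ?thesis by (simp add: scaleM2_dsa_def)
qed

lemma balanced_map_counit_right: "balanced_map (\<lambda>a b. a * eta_R (counit b))"
  and comult_counit_right: "tensor_lift (\<lambda>a b. a * eta_R (counit b)) (comult a) = a"
proof -
  let ?h = "tensor_lift (\<lambda>a b. a * eta_R (counit b))"
  have r: "ring_map (\<lambda>a. eta_R (counit a))" by (rule ring_map_comp[OF ring_map_eta_R ring_map_counit])
  note L = ring_map_tensor_lift[OF ring_map_id r, unfolded scaleM2_one_dsa counit_generators, OF refl]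
  show "balanced_map (\<lambda>a b. a * eta_R (counit b))" by (rule L)
  note pure = tensor_lift_pure[OF L(1)] and h = ring_mapD[OF L(2)]
  show "?h (comult a) = a"
  proof (rule dsa_ring_map_eqI[OF ring_map_comp[OF L(2) ring_map_comult] ring_map_id])
    show "?h (comult (eta_L m)) = eta_L m" for m
      by (simp add: comult_generators pure ring_mapD[OF r])
    show "?h (comult (xi_dsa n)) = xi_dsa n" for n
      by (simp add: comult_xi_tconv ring_map_tconv[OF L(2)] pure ring_mapD[OF r]
          tconv_counit_xi[OF ring_map_eta_R] tconv_unit_right)
    show "?h (comult (tau_dsa n)) = tau_dsa n" for n
      by (simp add: comult_tau_tconv h ring_map_tconv[OF L(2)] pure ring_mapD[OF r]
          tconv_zero_right ring_mapD[OF ring_map_eta_R])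
  qed
qed

text \<open>Every summand of the two recursions contains a positive power of some \<xi>_k with k
  \<ge> 1, which the counit kills. Hence the unit of the algebra, composed with c, is still the
  counit and acts trivially by counitality.\<close>

lemma counit_conjugation: "counit (conjugation a) = counit a"
proof (rule dsa_ring_map_eqI[OF ring_map_comp[OF ring_map_counit ring_map_conjugation] ring_map_counit])
  note c = ring_mapD[OF ring_map_counit] ring_map_sum[OF ring_map_counit]
  have xi: "i < n \<Longrightarrow> counit (xi_dsa (n - i)) = 0" for i n by simp
  show "counit (conjugation (eta_L m)) = counit (eta_L m)" for m
    by (simp add: conjugation_eta_L)
  show "counit (conjugation (tau_dsa n)) = counit (tau_dsa n)" for n
    by (subst conjugation_tau, subst conj_tau.simps) (simp add: c xi power_0_left)
  show "counit (conjugation (xi_dsa n)) = counit (xi_dsa n)" for n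
    by (subst conjugation_xi, subst conj_xi.simps) (simp add: c xi power_0_left)
qed

section \<open>The conjugation and its compatibility with the comultiplication\<close>

lemma tconv_xi_conj_xi: "tconv xi_dsa conj_xi = tconv_unit"
proof
  fix n
  show "tconv xi_dsa conj_xi n = tconv_unit n"
    \<comment> \<open>For \<open>n > 0\<close> the terms with \<open>i < n\<close> add up to
      \<open>conj_xi n\<close> by the recursion and cancel against the last term.\<close>
    using conj_xi.simps[of n] dsa_char_2[of "conj_xi n"] by (auto simp: tconv_split tconv_unit_def)
qed

lemma tconv_xi_conj_tau: "tconv xi_dsa conj_tau = tau_dsa"
proof
  fix n
  let ?s = "\<Sum>i<n. xi_dsa (n - i) ^ (2 ^ i) * conj_tau i"
  have "tconv xi_dsa conj_tau n = ?s + (tau_dsa n + ?s)"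
    using conj_tau.simps[of n] by (simp add: tconv_split)
  also have "\<dots> = tau_dsa n"
    by (simp only: add.commute[of "tau_dsa n"] dsa_char_2_left)
  finally show "tconv xi_dsa conj_tau n = tau_dsa n" .
qed

text \<open>The plain swap is incompatible with balancing, since the two factors are glued along
  different units; composing with c exchanges the units and repairs this.\<close>

definition conj_flip :: "dsa dsa_tensor \<Rightarrow> dsa dsa_tensor" where
  "conj_flip = tensor_lift (\<lambda>a b. conjugation b \<otimes>\<^sub>A conjugation a)"

lemma balanced_map_conj_flip: "balanced_map (\<lambda>a b. conjugation b \<otimes>\<^sub>A conjugation a)"
  and ring_map_conj_flip: "ring_map conj_flip"
proof -
  have f: "ring_map (\<lambda>a. (1::dsa) \<otimes>\<^sub>A conjugation a)"
    by (rule ring_map_comp[OF ring_map_tensor_inr ring_map_conjugation])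
  have g: "ring_map (\<lambda>a. conjugation a \<otimes>\<^sub>A (1::dsa))"
    by (rule ring_map_comp[OF ring_map_tensor_inl ring_map_conjugation])
  have fg: "1 \<otimes>\<^sub>A conjugation (eta_R m) = conjugation (m *\<^sub>M 1) \<otimes>\<^sub>A (1::dsa)" for m
    by (simp add: scaleM2_one_dsa conjugation_eta_R conjugation_eta_L pure_tensor_eta_L)
  note L = ring_map_tensor_lift[OF f g fg, unfolded pure_tensor_mult, simplified]
  show "balanced_map (\<lambda>a b. conjugation b \<otimes>\<^sub>A conjugation a)" by (rule L)
  show "ring_map conj_flip" unfolding conj_flip_def by (rule L)
qed

text \<open>Cancel \<Delta> \<xi> on the left. Both candidates for \<Delta> (c \<xi>) are then right
  inverses of \<xi>' * \<xi>'', and both candidates for \<Delta> (c \<tau>) convolve with it to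
  \<Delta> \<tau>.\<close>

lemma comult_conjugation: "comult (conjugation a) = conj_flip (comult a)"
proof (rule dsa_ring_map_eqI[OF ring_map_comp[OF ring_map_comult ring_map_conjugation]
      ring_map_comp[OF ring_map_conj_flip ring_map_comult]])
  note pure = tensor_lift_pure[OF balanced_map_conj_flip, folded conj_flip_def]
  note cj = ring_mapD[OF ring_map_conjugation] conjugation_xi conjugation_tau conjugation_eta_L
  note assoc = tconv_assoc[OF dsa_tensor_char_2]
  let ?l = "\<lambda>a. a \<otimes>\<^sub>A (1::dsa)" and ?r = "\<lambda>a::dsa. (1::dsa) \<otimes>\<^sub>A a"
  let ?X1 = "\<lambda>n. ?l (xi_dsa n)" and ?X2 = "\<lambda>n. ?r (xi_dsa n)"
  let ?T1 = "\<lambda>n. ?l (tau_dsa n)" and ?T2 = "\<lambda>n. ?r (tau_dsa n)"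
  let ?C1 = "\<lambda>n. ?l (conj_xi n)" and ?C2 = "\<lambda>n. ?r (conj_xi n)"
  let ?D1 = "\<lambda>n. ?l (conj_tau n)" and ?D2 = "\<lambda>n. ?r (conj_tau n)"
  have unit: "(\<lambda>n. h (tconv_unit n)) = tconv_unit" if "ring_map h"
    for h :: "dsa \<Rightarrow> dsa dsa_tensor"
    using ring_mapD[OF that] by (auto simp: tconv_unit_def)
  \<comment> \<open>Stated for every ring map, as it is applied to \<Delta> and to both inclusions
    of the tensor factors.\<close>
  have XC: "tconv (\<lambda>n. h (xi_dsa n)) (\<lambda>n. h (conj_xi n)) = tconv_unit" if "ring_map h"
    for h :: "dsa \<Rightarrow> dsa dsa_tensor"
    using ring_map_tconv[OF that, of xi_dsa conj_xi] unit[OF that]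
    by (simp add: tconv_xi_conj_xi fun_eq_iff)
  have XD: "tconv (\<lambda>n. h (xi_dsa n)) (\<lambda>n. h (conj_tau n)) = (\<lambda>n. h (tau_dsa n))" if "ring_map h"
    for h :: "dsa \<Rightarrow> dsa dsa_tensor"
    using ring_map_tconv[OF that, of xi_dsa conj_tau]
    by (simp add: tconv_xi_conj_tau fun_eq_iff)
  have X: "(\<lambda>n. comult (xi_dsa n)) = tconv ?X1 ?X2"
    by (simp add: comult_xi_tconv fun_eq_iff)
  have X0: "comult (xi_dsa 0) = 1" by (simp add: ring_mapD[OF ring_map_comult])
  have fX: "(\<lambda>n. conj_flip (comult (xi_dsa n))) = tconv ?C2 ?C1"
    by (simp add: comult_xi_tconv ring_map_tconv[OF ring_map_conj_flip] pure cj)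
  have fT: "(\<lambda>n. conj_flip (comult (tau_dsa n))) = (\<lambda>n. ?D2 n + tconv ?C2 ?D1 n)"
    by (simp add: comult_tau_tconv ring_map_tconv[OF ring_map_conj_flip] pure cj
        ring_mapD[OF ring_map_conj_flip])
  show "comult (conjugation (eta_L m)) = conj_flip (comult (eta_L m))" for m
    by (simp add: comult_generators(1) pure cj comult_eta_R)
  have *: "tconv (tconv ?X1 ?X2) (tconv ?C2 y) = tconv ?X1 y" for y
  proof -
    have "tconv (tconv ?X1 ?X2) (tconv ?C2 y) = tconv ?X1 (tconv (tconv ?X2 ?C2) y)"
      by (simp only: assoc)
    also have "\<dots> = tconv ?X1 y"
      by (simp only: XC[OF ring_map_tensor_inr] tconv_unit_left)
    finally show ?thesis .
  qed
  have "(\<lambda>n. comult (conj_xi n)) = tconv ?C2 ?C1"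
  proof (rule tconv_left_cancel)
    show "(\<lambda>n. comult (xi_dsa n)) 0 = 1" by (rule X0)
    show "tconv (\<lambda>n. comult (xi_dsa n)) (\<lambda>n. comult (conj_xi n))
        = tconv (\<lambda>n. comult (xi_dsa n)) (tconv ?C2 ?C1)"
      unfolding XC[OF ring_map_comult] unfolding X *
      by (simp only: XC[OF ring_map_tensor_inl])
  qed
  then show "comult (conjugation (xi_dsa n)) = conj_flip (comult (xi_dsa n))" for n
    by (simp add: cj fX[THEN fun_cong] fun_eq_iff)
  have "(\<lambda>n. comult (conj_tau n)) = (\<lambda>n. ?D2 n + tconv ?C2 ?D1 n)"
  proof (rule tconv_left_cancel)
    show "(\<lambda>n. comult (xi_dsa n)) 0 = 1" by (rule X0)
    \<comment> \<open>The summand c \<tau>'' contributes \<xi>' * \<tau>'' and the summand c \<xi>''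
      * c \<tau>' contributes \<tau>'; together they are \<Delta> \<tau>.\<close>
    have "tconv (tconv ?X1 ?X2) ?D2 = tconv ?X1 ?T2"
      by (simp only: assoc XD[OF ring_map_tensor_inr])
    then have "tconv (\<lambda>n. comult (xi_dsa n)) (\<lambda>n. ?D2 n + tconv ?C2 ?D1 n)
        = (\<lambda>n. tconv ?X1 ?T2 n + ?T1 n)"
      unfolding X tconv_add_right * XD[OF ring_map_tensor_inl] by simp
    also have "\<dots> = (\<lambda>n. comult (tau_dsa n))"
      by (simp add: comult_tau_tconv add.commute)
    finally show "tconv (\<lambda>n. comult (xi_dsa n)) (\<lambda>n. comult (conj_tau n))
        = tconv (\<lambda>n. comult (xi_dsa n)) (\<lambda>n. ?D2 n + tconv ?C2 ?D1 n)"
      unfolding XD[OF ring_map_comult] by simp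
  qed
  then show "comult (conjugation (tau_dsa n)) = conj_flip (comult (tau_dsa n))" for n
    by (simp add: cj fT[THEN fun_cong] fun_eq_iff)
qed


section \<open>Coassociativity\<close>

text \<open>
  Maps out of \<open>A \<otimes> (A \<otimes> N)\<close>, curried; the first tensor sign balances \<^const>\<open>eta_R\<close> against
  \<^const>\<open>eta_L\<close>.
\<close>

definition trilinear_map :: "(dsa \<Rightarrow> dsa \<Rightarrow> 'n::M2_module \<Rightarrow> 'b::ab_group_add) \<Rightarrow> bool" where
  "trilinear_map f \<longleftrightarrow>
     (\<forall>a. balanced_map (f a)) \<and>
     (\<forall>a a' b x. f (a + a') b x = f a b x + f a' b x) \<and>
     (\<forall>a m b x. f (a * eta_R m) b x = f a (eta_L m * b) x)"

lemma trilinear_mapD: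
  assumes "trilinear_map f"
  shows "balanced_map (f a)" "f (a + a') b x = f a b x + f a' b x"
    "f (a * eta_R m) b x = f a (eta_L m * b) x"
  using assms unfolding trilinear_map_def by blast+

lemma trilinear_balanced_left:
  assumes f: "trilinear_map f"
  shows "balanced_map (\<lambda>a b. f a b x)"
  unfolding balanced_map_def scaleM2_dsa_def
  by (simp add: balanced_mapD[OF trilinear_mapD(1)[OF f]] trilinear_mapD(2,3)[OF f])

text \<open>Scalars act on the inner tensor product through \<open>eta_L\<close> on the middle
  factor, so the last clause of \<open>trilinear_map\<close> is exactly the balancing of the outer
  tensor sign.\<close>

lemma trilinear_balanced_right:
  assumes f: "trilinear_map f"
  shows "balanced_map (\<lambda>a. tensor_lift (f a))"
proof -
  note bal = trilinear_mapD(1)[OF f]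
  note lift = tensor_lift_zero[OF bal] tensor_lift_add[OF bal] tensor_lift_pure[OF bal]
  have bal': "balanced_map (\<lambda>b. f a (eta_L m * b))" for a m
  proof -
    have "f (a * eta_R m) = (\<lambda>b. f a (eta_L m * b))"
      by (intro ext) (rule trilinear_mapD(3)[OF f])
    then show ?thesis using bal[of "a * eta_R m"] by simp
  qed
  note lift' = tensor_lift_zero[OF bal'] tensor_lift_add[OF bal'] tensor_lift_pure[OF bal']
  have "tensor_lift (f (a * eta_R m)) t = tensor_lift (f a) (m *\<^sub>M t)" for a m t
    by (induction t rule: dsa_tensor_induct)
      (simp_all add: lift lift' scaleM2_tensor_zero scaleM2_tensor_add scaleM2_pure_tensor
        trilinear_mapD(3)[OF f])
  moreover have "tensor_lift (f (a + b)) t = tensor_lift (f a) t + tensor_lift (f b) t" for a b t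
  proof -
    have "f (a + b) = (\<lambda>a' x. f a a' x + f b a' x)"
      by (intro ext) (rule trilinear_mapD(2)[OF f])
    then show ?thesis by (simp add: tensor_lift_fun_add)
  qed
  ultimately show ?thesis by (simp add: balanced_map_def lift(2))
qed

text \<open>With \<open>c = eta_R m\<close> this evaluates a lift at
  \<open>comult (a * eta_R m)\<close>.\<close>

lemma tensor_lift_mult_right:
  fixes f :: "dsa \<Rightarrow> dsa \<Rightarrow> 'b::ab_group_add"
  assumes f: "balanced_map f"
  shows "tensor_lift f (t * (1 \<otimes>\<^sub>A c)) = tensor_lift (\<lambda>a b. f a (b * c)) t"
proof -
  have g: "balanced_map (\<lambda>a b. f a (b * c))"
    by (simp add: balanced_map_def distrib_right balanced_mapD[OF f] scaleM2_mult)
  show ?thesis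
    by (induction t rule: dsa_tensor_induct)
      (simp_all add: tensor_mult_simps tensor_lift_zero tensor_lift_add tensor_lift_pure f g)
qed

lemma tensor_lift_mult_left:
  fixes f :: "dsa \<Rightarrow> dsa \<Rightarrow> 'b::ab_group_add"
  assumes f: "balanced_map f"
  shows "tensor_lift f ((c \<otimes>\<^sub>A 1) * t) = tensor_lift (\<lambda>a b. f (c * a) b) t"
proof -
  have g: "balanced_map (\<lambda>a b. f (c * a) b)"
    by (simp add: balanced_map_def distrib_left balanced_mapD[OF f] mult.assoc[symmetric])
  show ?thesis
    by (induction t rule: dsa_tensor_induct)
      (simp_all add: tensor_mult_simps tensor_lift_zero tensor_lift_add tensor_lift_pure f g)
qed

text \<open>A right scalar of \<open>a\<close> lands on the second part of \<Delta> a, where the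
  second tensor sign of \<open>f\<close> hands it on to \<open>x\<close>.\<close>

lemma trilinear_comult_balanced:
  assumes f: "trilinear_map f"
  shows "balanced_map (\<lambda>a x. tensor_lift (\<lambda>a' a''. f a' a'' x) (comult a))"
proof -
  note bal = trilinear_balanced_left[OF f]
  note bal' = trilinear_mapD(1)[OF f]
  have "tensor_lift (\<lambda>a' a''. f a' a'' x) (comult (a * eta_R m))
      = tensor_lift (\<lambda>a' a''. f a' a'' (m *\<^sub>M x)) (comult a)" for a m x
    by (simp only: ring_mapD(4)[OF ring_map_comult] comult_eta_R tensor_lift_mult_right[OF bal]
        balanced_mapD(3)[OF bal'])
  then show ?thesis
    by (simp add: balanced_map_def ring_mapD[OF ring_map_comult] tensor_lift_add[OF bal]
        balanced_mapD[OF bal'] tensor_lift_fun_add)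
qed

lemma trilinear_pure_tensor: "trilinear_map (\<lambda>a b x. a \<otimes>\<^sub>A (b \<otimes>\<^sub>A x))"
  by (simp add: trilinear_map_def balanced_map_def pure_tensor_add_left pure_tensor_add_right
      pure_tensor_balanced scaleM2_pure_tensor)

text \<open>Apply the two-stage lift of \<open>f\<close> to both sides of the coassociativity axiom.
  In this form the axiom can be used under an arbitrary evaluation: for the action with the coaction
  of \<open>N\<close>, and for the product of the algebra with \<open>comult\<close>.\<close>

lemma trilinear_coassoc:
  assumes \<psi>: "left_comodule \<psi>" and f: "trilinear_map f"
  shows "tensor_lift (\<lambda>a x. tensor_lift (\<lambda>a' a''. f a' a'' x) (comult a)) (\<psi> n)
    = tensor_lift (\<lambda>a x. tensor_lift (f a) (\<psi> x)) (\<psi> n)"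
proof -
  let ?F = "tensor_lift (\<lambda>a. tensor_lift (f a))"
  let ?l = "tensor_lift (\<lambda>a x. tensor_lift (\<lambda>a' a''. a' \<otimes>\<^sub>A (a'' \<otimes>\<^sub>A x)) (comult a)) (\<psi> n)"
  let ?r = "tensor_lift (\<lambda>a x. a \<otimes>\<^sub>A \<psi> x) (\<psi> n)"
  interpret module_hom scaleM2 scaleM2 \<psi> using \<psi> by (simp add: left_comodule_def)
  note bal = trilinear_balanced_right[OF f]
  note F = tensor_lift_add[OF bal]
  have "?l = ?r" using \<psi> by (simp add: left_comodule_def)
  moreover have "?F ?l = tensor_lift (\<lambda>a x. tensor_lift (\<lambda>a' a''. f a' a'' x) (comult a)) (\<psi> n)"
    by (simp add: additive_tensor_lift[of ?F, OF F trilinear_comult_balanced[OF trilinear_pure_tensor]]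
        additive_tensor_lift[of ?F, OF F trilinear_balanced_left[OF trilinear_pure_tensor]]
        tensor_lift_pure[OF bal] tensor_lift_pure[OF trilinear_mapD(1)[OF f]])
  moreover have "?F ?r = tensor_lift (\<lambda>a x. tensor_lift (f a) (\<psi> x)) (\<psi> n)"
  proof -
    have "balanced_map (\<lambda>a x. a \<otimes>\<^sub>A \<psi> x)"
      by (simp add: balanced_map_def pure_tensor_add_left pure_tensor_add_right add scale
          pure_tensor_balanced)
    then show ?thesis
      by (simp add: additive_tensor_lift[of ?F, OF F] tensor_lift_pure[OF bal])
  qed
  ultimately show ?thesis by simp
qed

text \<open>Viewing the dual Steenrod algebra as a comodule over itself makes associativity of the
  product an instance of \<open>trilinear_coassoc\<close>. On generators, coassociativity is
  associativity of twisted convolution.\<close>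

lemma comult_left_comodule: "left_comodule comult"
  unfolding left_comodule_def
proof (intro conjI allI)
  show "module_hom scaleM2 scaleM2 comult"
  proof (unfold module_hom_iff, intro conjI allI)
    fix m and a b :: dsa
    show "comult (a + b) = comult a + comult b" by (rule ring_mapD[OF ring_map_comult])
    show "comult (m *\<^sub>M a) = m *\<^sub>M comult a"
      using scaleM2_mult[of m 1 "comult a"]
      by (simp add: scaleM2_dsa_def ring_mapD[OF ring_map_comult] comult_generators(1)
          scaleM2_one_tensor)
  qed (rule M2_module.module_axioms)+
  show "tensor_lift (\<lambda>a x. counit a *\<^sub>M x) (comult n) = n" for n
    by (rule comult_counit_left)
  note inl = ring_map_tensor_inl and inr = ring_map_tensor_inr
  let ?i1 = "\<lambda>a::dsa. a \<otimes>\<^sub>A (1 :: dsa dsa_tensor)"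
  \<comment> \<open>The three maps include the factors of the triple tensor product;
    \<open>f12\<close> and \<open>f23\<close> below match their units.\<close>
  let ?i2 = "\<lambda>a::dsa. 1 \<otimes>\<^sub>A (a \<otimes>\<^sub>A (1::dsa))"
  let ?i3 = "\<lambda>a::dsa. 1 \<otimes>\<^sub>A (1 \<otimes>\<^sub>A a)"
  have i2: "ring_map ?i2" and i3: "ring_map ?i3"
    by (rule ring_map_comp[OF inr inl], rule ring_map_comp[OF inr inr])
  have f12: "?i1 (eta_R m) = ?i2 (m *\<^sub>M 1)" for m
    using pure_tensor_balanced[of 1 m "1 :: dsa dsa_tensor"]
    by (simp add: scaleM2_one_dsa scaleM2_one_tensor)
  \<comment> \<open>\<open>E\<close> places a tensor of two factors in the first two positions,
    already reassociated.\<close>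
  define E where "E = tensor_lift (\<lambda>a b. ?i1 a * ?i2 b)"
  note E = ring_map_tensor_lift[OF inl i2 f12, folded E_def]
  note Ep = tensor_lift_pure[OF E(1), folded E_def]
  have f23: "E (comult (eta_R m)) = ?i3 (m *\<^sub>M 1)" for m
    by (simp add: comult_eta_R Ep scaleM2_one_dsa ring_mapD[OF inl] pure_tensor_eta_L)
  \<comment> \<open>\<open>L\<close> is \<Delta> \<otimes> id followed by reassociation, and
    \<open>R\<close> below is id \<otimes> \<Delta>; both are ring maps.\<close>
  define L where "L = tensor_lift (\<lambda>a b. E (comult a) * ?i3 b)"
  note L = ring_map_tensor_lift[OF ring_map_comp[OF E(2) ring_map_comult] i3 f23, folded L_def]
  note Lp = tensor_lift_pure[OF L(1), folded L_def]
  have f1c: "?i1 (eta_R m) = 1 \<otimes>\<^sub>A comult (m *\<^sub>M 1)" for m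
    using f12 by (simp add: scaleM2_one_dsa comult_generators(1))
  define R where "R = tensor_lift (\<lambda>a b. ?i1 a * (1 \<otimes>\<^sub>A comult b))"
  note R = ring_map_tensor_lift[OF inl ring_map_comp[OF inr ring_map_comult] f1c, folded R_def]
  note Rp = tensor_lift_pure[OF R(1), folded R_def]
  let ?X1 = "\<lambda>n. ?i1 (xi_dsa n)" and ?X2 = "\<lambda>n. ?i2 (xi_dsa n)" and ?X3 = "\<lambda>n. ?i3 (xi_dsa n)"
  note assoc = tconv_assoc[OF dsa_tensor_char_2, THEN fun_cong]
  have "L (comult a) = R (comult a)" for a
  proof (rule dsa_ring_map_eqI[OF ring_map_comp[OF L(2) ring_map_comult]
        ring_map_comp[OF R(2) ring_map_comult]])
    have Ex: "E (comult (xi_dsa n)) = tconv ?X1 ?X2 n" for n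
      by (simp add: comult_xi_tconv ring_map_tconv[OF E(2)] Ep ring_mapD[OF inl] ring_mapD[OF i2])
    have Et: "E (comult (tau_dsa n)) = ?i1 (tau_dsa n) + tconv ?X1 (\<lambda>n. ?i2 (tau_dsa n)) n" for n
      by (simp add: comult_tau_tconv ring_mapD[OF E(2)] ring_map_tconv[OF E(2)] Ep
          ring_mapD[OF inl] ring_mapD[OF i2])
    have Rx: "R (comult (xi_dsa n)) = tconv ?X1 (tconv ?X2 ?X3) n" for n
      by (simp add: comult_xi_tconv ring_map_tconv[OF R(2)] Rp ring_map_tconv[OF inr]
          ring_mapD[OF inl] ring_mapD[OF inr] ring_mapD[OF ring_map_comult])
    show "L (comult (eta_L m)) = R (comult (eta_L m))" for m
      by (simp add: comult_generators(1) Lp Rp Ep ring_mapD[OF ring_map_comult] ring_mapD[OF inl]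
          ring_mapD[OF inr])
    show "L (comult (xi_dsa n)) = R (comult (xi_dsa n))" for n
      unfolding Rx
      by (subst comult_xi_tconv)
        (simp add: ring_map_tconv[OF L(2)] Lp Ex ring_mapD[OF ring_map_comult] ring_mapD[OF i3]
          ring_mapD[OF E(2)] assoc)
    have "R (comult (tau_dsa n)) = ?i1 (tau_dsa n)
        + tconv ?X1 (\<lambda>n. ?i2 (tau_dsa n) + tconv ?X2 (\<lambda>n. ?i3 (tau_dsa n)) n) n" for n
      by (simp add: comult_tau_tconv ring_mapD[OF R(2)] ring_map_tconv[OF R(2)] Rp
          ring_map_tconv[OF inr] pure_tensor_add_right
          ring_mapD[OF inl] ring_mapD[OF inr] ring_mapD[OF ring_map_comult])
    then show "L (comult (tau_dsa n)) = R (comult (tau_dsa n))" for n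
      by (subst comult_tau_tconv)
        (simp add: ring_mapD[OF L(2)] ring_map_tconv[OF L(2)] Lp Ex Et tconv_add_right assoc
          ring_mapD[OF ring_map_comult] ring_mapD[OF i3] ring_mapD[OF E(2)] add.assoc)
  qed
  moreover have "E t * ?i3 x = tensor_lift (\<lambda>a' a''. a' \<otimes>\<^sub>A (a'' \<otimes>\<^sub>A x)) t" for t x
  proof -
    have "E t * ?i3 x = tensor_lift (\<lambda>a' a''. ?i1 a' * ?i2 a'' * ?i3 x) t"
      unfolding E_def by (rule additive_tensor_lift[OF distrib_right E(1)])
    then show ?thesis by (simp add: pure_tensor_mult)
  qed
  moreover have "?i1 a * (1 \<otimes>\<^sub>A comult b) = a \<otimes>\<^sub>A comult b" for a b
    by (simp add: pure_tensor_mult)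
  ultimately show "tensor_lift (\<lambda>a x. tensor_lift (\<lambda>a' a''. a' \<otimes>\<^sub>A (a'' \<otimes>\<^sub>A x)) (comult a)) (comult n)
      = tensor_lift (\<lambda>a x. a \<otimes>\<^sub>A comult x) (comult n)" for n
    by (simp add: L_def R_def)
qed


section \<open>Homogeneous elements\<close>

text \<open>One closure predicate serves the prime field, \<open>M2\<close>, the dual algebra, its
  tensor square, and the polynomial rings in between.\<close>

definition graded_ring :: "(int \<times> int \<Rightarrow> 'a::comm_ring_1 set) \<Rightarrow> bool" where
  "graded_ring P \<longleftrightarrow>
     (\<forall>d. 0 \<in> P d \<and> (\<forall>x\<in>P d. \<forall>y\<in>P d. x + y \<in> P d)) \<and> 1 \<in> P 0 \<and>
     (\<forall>d e. \<forall>x\<in>P d. \<forall>y\<in>P e. x * y \<in> P (d + e))"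

lemma graded_ringD:
  assumes "graded_ring P"
  shows "0 \<in> P d" "x \<in> P d \<Longrightarrow> y \<in> P d \<Longrightarrow> x + y \<in> P d" "1 \<in> P 0"
    "x \<in> P d \<Longrightarrow> y \<in> P e \<Longrightarrow> x * y \<in> P (d + e)"
  using assms unfolding graded_ring_def by blast+

lemma graded_ring_mult_eq:
  "graded_ring P \<Longrightarrow> x \<in> P d \<Longrightarrow> y \<in> P e \<Longrightarrow> d + e = f \<Longrightarrow> x * y \<in> P f"
  using graded_ringD(4) by blast

lemma graded_ring_sum:
  assumes "graded_ring P" "\<And>i. i \<in> I \<Longrightarrow> f i \<in> P d"
  shows "(\<Sum>i\<in>I. f i) \<in> P d"
  using assms(2)
  by (induction I rule: infinite_finite_induct) (auto intro: graded_ringD[OF assms(1)])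

definition scale_degree :: "nat \<Rightarrow> int \<times> int \<Rightarrow> int \<times> int" where
  "scale_degree n d = (int n * fst d, int n * snd d)"

lemma graded_ring_power:
  assumes "graded_ring P" "x \<in> P d"
  shows "x ^ n \<in> P (scale_degree n d)"
proof (induction n)
  case 0
  then show ?case using graded_ringD(3)[OF assms(1)] by (simp add: scale_degree_def zero_prod_def)
next
  case (Suc n)
  have "d + scale_degree n d = scale_degree (Suc n) d"
    by (cases d) (simp add: scale_degree_def algebra_simps)
  with Suc show ?case using graded_ring_mult_eq[OF assms Suc] by simp
qed

section \<open>Bidegrees of monomials and polynomials\<close>

lemma monom_degree_superset:
  assumes "finite S" "Poly_Mapping.keys m \<subseteq> S"
  shows "monom_degree deg m = (\<Sum>v\<in>S. scale_degree (Poly_Mapping.lookup m v) (deg v))"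
  unfolding monom_degree_def scale_degree_def
  by (rule sum.mono_neutral_left) (use assms in \<open>auto simp: in_keys_iff zero_prod_def\<close>)

lemma monom_degree_add: "monom_degree deg (m + m') = monom_degree deg m + monom_degree deg m'"
proof -
  let ?S = "Poly_Mapping.keys m \<union> Poly_Mapping.keys m'"
  have "Poly_Mapping.keys (m + m') \<subseteq> ?S" by (rule Poly_Mapping.keys_add)
  moreover have "scale_degree (i + j) d = scale_degree i d + scale_degree j d" for i j d
    by (simp add: scale_degree_def algebra_simps)
  ultimately show ?thesis
    by (simp add: monom_degree_superset[of ?S] lookup_add sum.distrib)
qed

lemma monom_degree_single: "monom_degree deg (Poly_Mapping.single v n) = scale_degree n (deg v)"
  by (subst monom_degree_superset[of "{v}"]) auto

lemma monom_degree_0: "monom_degree deg 0 = 0"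
  by (simp add: monom_degree_def)

lemma graded_monom_eval:
  assumes P: "graded_ring P" and g: "\<And>v. g v \<in> P (deg v)"
  shows "monom_eval g m \<in> P (monom_degree deg m)"
proof (induction m rule: poly_mapping_monomial_induct)
  case zero
  show ?case using graded_ringD(3)[OF P] by (simp add: monom_degree_0)
next
  case (add m v n)
  then show ?case
    unfolding monom_eval_add monom_degree_add monom_degree_single monom_eval_single
    by (intro graded_ringD(4)[OF P] graded_ring_power[OF P] g)
qed

text \<open>The coefficients carry degrees of their own. The construction is used twice: over the
  prime field for \<open>M2\<close>, and over \<open>M2\<close> for the polynomial ring above the
  dual algebra.\<close>

definition mpoly_piece ::
  "(int \<times> int \<Rightarrow> 'r::comm_ring_1 set) \<Rightarrow> ('v \<Rightarrow> int \<times> int) \<Rightarrow> int \<times> int \<Rightarrow> ('v, 'r) mpoly set" where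
  "mpoly_piece P deg d = {p. \<forall>k\<in>Poly_Mapping.keys p. Poly_Mapping.lookup p k \<in> P (d - monom_degree deg k)}"

lemma mpoly_piece_lookup:
  "graded_ring P \<Longrightarrow> p \<in> mpoly_piece P deg d \<longleftrightarrow>
    (\<forall>k. Poly_Mapping.lookup p k \<in> P (d - monom_degree deg k))"
  unfolding mpoly_piece_def mem_Collect_eq in_keys_iff Ball_def by (metis graded_ringD(1))

text \<open>All structure maps are polynomial evaluations, so degree preservation only has to be
  checked on coefficients and generators.\<close>

lemma graded_poly_eval:
  assumes Q: "graded_ring Q" and h: "\<And>d c. c \<in> P d \<Longrightarrow> h c \<in> Q d"
    and g: "\<And>v. g v \<in> Q (deg v)" and p: "p \<in> mpoly_piece P deg d"
  shows "poly_eval h g p \<in> Q d"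
  unfolding poly_eval_def
proof (rule graded_ring_sum[OF Q])
  fix k assume "k \<in> Poly_Mapping.keys p"
  with p have "h (Poly_Mapping.lookup p k) \<in> Q (d - monom_degree deg k)"
    by (auto simp: mpoly_piece_def intro: h)
  from graded_ring_mult_eq[OF Q this graded_monom_eval[of Q g deg k, OF Q g]]
  show "h (Poly_Mapping.lookup p k) * monom_eval g k \<in> Q d" by simp
qed

lemma graded_ring_mpoly_piece:
  assumes P: "graded_ring P"
  shows "graded_ring (mpoly_piece P deg)"
proof -
  note lu = mpoly_piece_lookup[OF P]
  have zero: "0 \<in> mpoly_piece P deg d" for d by (simp add: mpoly_piece_def)
  have add: "p + q \<in> mpoly_piece P deg d"
    if "p \<in> mpoly_piece P deg d" "q \<in> mpoly_piece P deg d" for p q d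
    using that by (auto simp: lu lookup_add intro: graded_ringD[OF P])
  have sum: "(\<Sum>i\<in>I. f i) \<in> mpoly_piece P deg d" if "\<And>i. i \<in> I \<Longrightarrow> f i \<in> mpoly_piece P deg d"
    for I and f :: "('b \<Rightarrow>\<^sub>0 nat) \<Rightarrow> _" and d
    using that by (induction I rule: infinite_finite_induct) (auto intro: zero add)
  have single: "Poly_Mapping.single k c \<in> mpoly_piece P deg d"
    if "c \<in> P (d - monom_degree deg k)" for k c d
    using that by (auto simp: mpoly_piece_def lookup_single split: if_splits)
  have expand: "p = (\<Sum>k\<in>Poly_Mapping.keys p. Poly_Mapping.single k (Poly_Mapping.lookup p k))"
    for p :: "('b, 'a) mpoly"
    by (rule poly_mapping_eqI) (simp add: lookup_sum lookup_single when_def in_keys_iff)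
  have mult: "p * q \<in> mpoly_piece P deg (d + e)"
    if p: "p \<in> mpoly_piece P deg d" and q: "q \<in> mpoly_piece P deg e" for p q d e
  proof -
    have "p * q = (\<Sum>k\<in>Poly_Mapping.keys p. \<Sum>l\<in>Poly_Mapping.keys q.
        Poly_Mapping.single (k + l) (Poly_Mapping.lookup p k * Poly_Mapping.lookup q l))"
      by (subst expand[of p], subst expand[of q]) (simp only: sum_product mult_single)
    also have "\<dots> \<in> mpoly_piece P deg (d + e)"
    proof (intro sum single)
      fix k l
      show "Poly_Mapping.lookup p k * Poly_Mapping.lookup q l \<in> P (d + e - monom_degree deg (k + l))"
        by (rule graded_ring_mult_eq[OF P p[unfolded lu, rule_format] q[unfolded lu, rule_format]])
          (simp add: monom_degree_add)
    qed
    finally show ?thesis .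
  qed
  have "1 \<in> mpoly_piece P deg 0"
    using single[of 1 0 0] graded_ringD(3)[OF P] by (simp add: monom_degree_0)
  then show ?thesis by (auto simp: graded_ring_def zero add mult)
qed

definition bit_piece :: "int \<times> int \<Rightarrow> bit set" where
  "bit_piece d = (if d = 0 then UNIV else {0})"

lemma graded_ring_bit_piece: "graded_ring bit_piece"
  unfolding graded_ring_def bit_piece_def by (simp del: split_paired_All)

lemma M2_piece_eq: "M2_piece = mpoly_piece bit_piece M2_gen_degree"
  by (auto simp: M2_piece_def mpoly_piece_def bit_piece_def in_keys_iff fun_eq_iff)

lemma graded_ring_M2_piece: "graded_ring M2_piece"
  unfolding M2_piece_eq by (rule graded_ring_mpoly_piece[OF graded_ring_bit_piece])

lemma dsa_piece_eq: "dsa_piece d = abs_dsa ` mpoly_piece M2_piece dsa_gen_degree d"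
proof -
  have "(\<forall>l\<in>Poly_Mapping.keys q. x + monom_degree M2_gen_degree l = d) \<longleftrightarrow> q \<in> M2_piece (d - x)"
    for q x by (auto simp: M2_piece_def algebra_simps)
  then show ?thesis by (simp add: dsa_piece_def mpoly_piece_def)
qed

lemma graded_ring_dsa_piece: "graded_ring dsa_piece"
proof -
  note g = graded_ringD[OF graded_ring_mpoly_piece[OF graded_ring_M2_piece, of dsa_gen_degree]]
  show ?thesis
    unfolding graded_ring_def dsa_piece_eq
    by (intro conjI allI ballI)
      (auto simp del: split_paired_All simp: zero_dsa.abs_eq one_dsa.abs_eq plus_dsa.abs_eq
        times_dsa.abs_eq intro!: imageI g)
qed

lemma graded_Var: "graded_ring P \<Longrightarrow> Var v \<in> mpoly_piece P deg (deg v)"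
  using graded_ringD(3)
  by (auto simp: Var_def mpoly_piece_def monom_degree_single scale_degree_def zero_prod_def[symmetric])

lemma graded_Const: "c \<in> P d \<Longrightarrow> Const c \<in> mpoly_piece P deg d"
  by (auto simp: Const_def mpoly_piece_def monom_degree_0)

section \<open>The structure maps preserve bidegrees\<close>

lemma eta_L_piece: "m \<in> M2_piece d \<Longrightarrow> eta_L m \<in> dsa_piece d"
  by (simp add: eta_L_def dsa_piece_eq graded_Const)

lemma tau_dsa_piece: "tau_dsa n \<in> dsa_piece (dsa_gen_degree (Tau_gen n))"
  by (simp add: tau_dsa_def tau_poly_def dsa_piece_eq graded_Var graded_ring_M2_piece)

lemma xi_dsa_piece: "xi_dsa n \<in> dsa_piece (2 ^ (n + 1) - 2, 2 ^ n - 1)"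
proof (cases n)
  case 0
  then show ?thesis
    using graded_ringD(3)[OF graded_ring_dsa_piece] by (simp add: zero_prod_def)
next
  case (Suc k)
  have "xi_dsa n \<in> dsa_piece (dsa_gen_degree (Xi_gen k))"
    using Suc by (simp add: xi_dsa_def dsa_piece_eq graded_Var graded_ring_M2_piece)
  then show ?thesis using Suc by (simp add: dsa_gen_degree_def)
qed

lemma of_bit_piece: "graded_ring P \<Longrightarrow> c \<in> bit_piece d \<Longrightarrow> of_bit c \<in> P d"
  by (cases c) (auto simp: bit_piece_def graded_ringD split: if_splits)

lemma eta_R_piece:
  assumes "m \<in> M2_piece d"
  shows "eta_R m \<in> dsa_piece d"
  unfolding eta_R_def
proof (rule graded_poly_eval[OF graded_ring_dsa_piece of_bit_piece[OF graded_ring_dsa_piece]])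
  note D = graded_ring_dsa_piece
  have v: "eta_L (Var v) \<in> dsa_piece (M2_gen_degree v)" for v
    by (rule eta_L_piece) (simp add: M2_piece_eq graded_Var graded_ring_bit_piece)
  \<comment> \<open>The degrees (-1,-1) of \<rho> and (1,0) of \<tau>_0 add up to (0,-1), the degree
    of \<tau>.\<close>
  have "eta_L rho * tau_dsa 0 \<in> dsa_piece (M2_gen_degree Tau)"
    by (rule graded_ring_mult_eq[OF D v tau_dsa_piece])
      (simp add: M2_gen_degree_def dsa_gen_degree_def)
  then show "(case v of Tau \<Rightarrow> eta_L tau + eta_L rho * tau_dsa 0 | Rho \<Rightarrow> eta_L rho)
      \<in> dsa_piece (M2_gen_degree v)" for v
    by (cases v) (auto intro: v graded_ringD(2)[OF D])
  show "m \<in> mpoly_piece bit_piece M2_gen_degree d" using assms by (simp add: M2_piece_eq)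
qed

lemma counit_piece:
  assumes "a \<in> dsa_piece d"
  shows "counit a \<in> M2_piece d"
proof -
  from assms obtain p where p: "p \<in> mpoly_piece M2_piece dsa_gen_degree d" and a: "a = abs_dsa p"
    by (auto simp: dsa_piece_eq)
  show ?thesis
    unfolding a counit.abs_eq
    by (rule graded_poly_eval[OF graded_ring_M2_piece _ _ p])
      (auto intro: graded_ringD(1)[OF graded_ring_M2_piece])
qed

text \<open>The summands of a twisted convolution all have the same degree. The offset
  \<open>c\<close> is 2 for the \<xi> family and 1 for the \<tau> family.\<close>

lemma xi_power_mult_piece:
  assumes "i \<le> n" "a \<in> dsa_piece (2 ^ (i + 1) - c, 2 ^ i - 1)"
  shows "xi_dsa (n - i) ^ (2 ^ i) * a \<in> dsa_piece (2 ^ (n + 1) - c, 2 ^ n - 1)"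
proof (rule graded_ring_mult_eq[OF graded_ring_dsa_piece
      graded_ring_power[OF graded_ring_dsa_piece xi_dsa_piece] assms(2)])
  have "(2::int) ^ n = 2 ^ i * 2 ^ (n - i)"
    using assms(1) by (simp add: power_add[symmetric])
  then show "scale_degree (2 ^ i) (2 ^ (n - i + 1) - 2, 2 ^ (n - i) - 1)
      + (2 ^ (i + 1) - c, 2 ^ i - 1) = (2 ^ (n + 1) - c, 2 ^ n - 1)"
    by (simp add: scale_degree_def algebra_simps)
qed

lemma conj_xi_piece: "conj_xi n \<in> dsa_piece (2 ^ (n + 1) - 2, 2 ^ n - 1)"
proof (induction n rule: less_induct)
  case (less n)
  show ?case
  proof (cases "n = 0")
    case True
    then show ?thesis
      using graded_ringD(3)[OF graded_ring_dsa_piece] by (simp add: conj_xi.simps[of 0] zero_prod_def)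
  next
    case False
    have "(\<Sum>i<n. xi_dsa (n - i) ^ (2 ^ i) * conj_xi i) \<in> dsa_piece (2 ^ (n + 1) - 2, 2 ^ n - 1)"
      by (intro graded_ring_sum[OF graded_ring_dsa_piece] xi_power_mult_piece less) auto
    with False show ?thesis by (subst conj_xi.simps) simp
  qed
qed

lemma conj_tau_piece: "conj_tau n \<in> dsa_piece (dsa_gen_degree (Tau_gen n))"
proof (induction n rule: less_induct)
  case (less n)
  have deg: "dsa_gen_degree (Tau_gen k) = (2 ^ (k + 1) - 1, 2 ^ k - 1)" for k
    by (simp add: dsa_gen_degree_def)
  have "(\<Sum>i<n. xi_dsa (n - i) ^ (2 ^ i) * conj_tau i) \<in> dsa_piece (dsa_gen_degree (Tau_gen n))"
    unfolding deg
    by (intro graded_ring_sum[OF graded_ring_dsa_piece] xi_power_mult_piece less[unfolded deg])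
      auto
  then show ?case
    by (subst conj_tau.simps) (intro graded_ringD(2)[OF graded_ring_dsa_piece] tau_dsa_piece)
qed

lemma conjugation_piece:
  assumes "a \<in> dsa_piece d"
  shows "conjugation a \<in> dsa_piece d"
proof -
  from assms obtain p where p: "p \<in> mpoly_piece M2_piece dsa_gen_degree d" and a: "a = abs_dsa p"
    by (auto simp: dsa_piece_eq)
  show ?thesis
    unfolding a conjugation.abs_eq
  proof (rule graded_poly_eval[OF graded_ring_dsa_piece eta_R_piece _ p])
    show "(case v of Tau_gen n \<Rightarrow> conj_tau n | Xi_gen n \<Rightarrow> conj_xi (n + 1))
        \<in> dsa_piece (dsa_gen_degree v)" for v
    proof (cases v)
      case (Tau_gen n)
      then show ?thesis using conj_tau_piece[of n] by simp
    next
      case (Xi_gen n)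
      then show ?thesis using conj_xi_piece[of "n + 1"] by (simp add: dsa_gen_degree_def)
    qed
  qed
qed

lemma tensor_piece_pure:
  "a \<in> dsa_piece e \<Longrightarrow> n \<in> G e' \<Longrightarrow> e + e' = d \<Longrightarrow> a \<otimes>\<^sub>A n \<in> tensor_piece G d"
  using tensor_piece.add[OF tensor_piece.zero, of a e n G e' d] by simp

lemma tensor_piece_add:
  assumes "s \<in> tensor_piece G d" "t \<in> tensor_piece G d"
  shows "s + t \<in> tensor_piece G d"
  using assms(2)
proof induction
  case (add t a e n e')
  then show ?case using tensor_piece.add[of "s + t" G d a e n e'] by (simp add: add.assoc)
qed (simp add: assms(1))

lemma graded_ring_tensor_piece: "graded_ring (tensor_piece dsa_piece)"
proof -
  note D = graded_ringD[OF graded_ring_dsa_piece]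
  have pure: "(a \<otimes>\<^sub>A b) * t \<in> tensor_piece dsa_piece (d + e)"
    if t: "t \<in> tensor_piece dsa_piece e" and "a \<in> dsa_piece d1" "b \<in> dsa_piece d2" "d1 + d2 = d"
    for t a b d e d1 d2
    using t
  proof induction
    case zero
    show ?case by (simp add: tensor_piece.zero)
  next
    case (add t a' e1 b' e2)
    have "(a * a') \<otimes>\<^sub>A (b * b') \<in> tensor_piece dsa_piece (d + e)"
      by (rule tensor_piece_pure[where e = "d1 + e1" and e' = "d2 + e2"])
        (use add that in \<open>auto intro: D(4)\<close>)
    with add show ?case by (simp add: distrib_left pure_tensor_mult tensor_piece_add)
  qed
  have mult: "s * t \<in> tensor_piece dsa_piece (d + e)"
    if s: "s \<in> tensor_piece dsa_piece d" and t: "t \<in> tensor_piece dsa_piece e" for s t d e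
    using s
  proof induction
    case zero
    show ?case by (simp add: tensor_piece.zero)
  next
    case (add s a d1 b d2)
    with pure[OF t] show ?case by (simp add: distrib_right tensor_piece_add)
  qed
  have "1 \<in> tensor_piece dsa_piece 0"
    unfolding one_dsa_tensor_def by (rule tensor_piece_pure[of _ 0 _ dsa_piece 0, OF D(3) D(3)]) simp
  then show ?thesis by (auto simp: graded_ring_def mult tensor_piece_add tensor_piece.zero)
qed

lemma comult_piece:
  assumes "a \<in> dsa_piece d"
  shows "comult a \<in> tensor_piece dsa_piece d"
proof -
  note T = graded_ring_tensor_piece and D = graded_ring_dsa_piece
  have inl: "a \<otimes>\<^sub>A 1 \<in> tensor_piece dsa_piece d" if "a \<in> dsa_piece d" for a d
    by (rule tensor_piece_pure[of _ d _ dsa_piece 0, OF that graded_ringD(3)[OF D]]) simp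
  \<comment> \<open>As for the conjugation, \<open>c\<close> will be 2 for \<open>comult_xi\<close>
    and 1 for \<open>comult_tau\<close>.\<close>
  have sum: "(\<Sum>i\<le>n. (xi_dsa (n - i) ^ (2 ^ i)) \<otimes>\<^sub>A b i)
      \<in> tensor_piece dsa_piece (2 ^ (n + 1) - c, 2 ^ n - 1)"
    if b: "\<And>i. b i \<in> dsa_piece (2 ^ (i + 1) - c, 2 ^ i - 1)" for n b c
  proof (rule graded_ring_sum[OF T])
    fix i assume "i \<in> {..n}"
    then have "(2::int) ^ n = 2 ^ i * 2 ^ (n - i)" by (simp add: power_add[symmetric])
    then show "(xi_dsa (n - i) ^ (2 ^ i)) \<otimes>\<^sub>A b i
        \<in> tensor_piece dsa_piece (2 ^ (n + 1) - c, 2 ^ n - 1)"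
      by (intro tensor_piece_pure[of _ _ _ dsa_piece, OF graded_ring_power[OF D xi_dsa_piece] b])
        (simp add: scale_degree_def algebra_simps)
  qed
  have deg: "dsa_gen_degree (Tau_gen k) = (2 ^ (k + 1) - 1, 2 ^ k - 1)" for k
    by (simp add: dsa_gen_degree_def)
  have xi: "comult_xi (n + 1) \<in> tensor_piece dsa_piece (dsa_gen_degree (Xi_gen n))" for n
    using sum[OF xi_dsa_piece, of "n + 1"] by (simp add: dsa_gen_degree_def comult_xi_def)
  have tau: "comult_tau n \<in> tensor_piece dsa_piece (dsa_gen_degree (Tau_gen n))" for n
    unfolding comult_tau_def
    using sum[of tau_dsa 1 n] inl[OF tau_dsa_piece, of n] tau_dsa_piece[unfolded deg]
    by (intro tensor_piece_add) (auto simp: deg)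
  from assms obtain p where p: "p \<in> mpoly_piece M2_piece dsa_gen_degree d" and a: "a = abs_dsa p"
    by (auto simp: dsa_piece_eq)
  show ?thesis
    unfolding a comult.abs_eq
  proof (rule graded_poly_eval[OF T _ _ p])
    show "eta_L c \<otimes>\<^sub>A 1 \<in> tensor_piece dsa_piece e" if "c \<in> M2_piece e" for c e
      by (rule inl[OF eta_L_piece[OF that]])
    show "(case v of Tau_gen n \<Rightarrow> comult_tau n | Xi_gen n \<Rightarrow> comult_xi (n + 1))
        \<in> tensor_piece dsa_piece (dsa_gen_degree v)" for v
      using xi tau by (cases v) auto
  qed
qed


section \<open>The Steenrod algebra and its action\<close>

lemma M2_linear_iff:
  "module_hom scaleM2 (*) (\<phi> :: dsa \<Rightarrow> M2) \<longleftrightarrow>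
    (\<forall>a b. \<phi> (a + b) = \<phi> a + \<phi> b) \<and> (\<forall>m a. \<phi> (eta_L m * a) = m * \<phi> a)"
proof -
  have "Modules.module ((*) :: M2 \<Rightarrow> M2 \<Rightarrow> M2)"
    by unfold_locales (simp_all add: algebra_simps)
  then show ?thesis
    unfolding module_hom_iff using M2_module.module_axioms by (auto simp: scaleM2_dsa_def)
qed

lemma M2_linearD:
  assumes "module_hom scaleM2 (*) (\<phi> :: dsa \<Rightarrow> M2)"
  shows "\<phi> (a + b) = \<phi> a + \<phi> b" "\<phi> (eta_L m * a) = m * \<phi> a" "\<phi> 0 = 0"
proof -
  show *: "\<phi> (a + b) = \<phi> a + \<phi> b" "\<phi> (eta_L m * a) = m * \<phi> a" for a b m
    using assms unfolding M2_linear_iff by blast+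
  show "\<phi> 0 = 0" using *(1)[of 0 0] by simp
qed

section \<open>The product of linear functionals\<close>

abbreviation steenrod_mult :: "(dsa \<Rightarrow> M2) \<Rightarrow> (dsa \<Rightarrow> M2) \<Rightarrow> dsa \<Rightarrow> M2" where
  "steenrod_mult \<phi> \<psi> a \<equiv> tensor_lift (\<lambda>a' a''. \<phi> (a' * eta_R (\<psi> a''))) (comult a)"

text \<open>Linearity of \<open>\<psi>\<close> pulls a scalar out of \<open>a''\<close>, and
  \<open>eta_R\<close> turns it into a right scalar on \<open>a'\<close>; hence the product formula
  is well defined.\<close>

lemma balanced_map_steenrod_mult:
  fixes \<phi> \<psi> :: "dsa \<Rightarrow> M2"
  assumes "module_hom scaleM2 (*) \<phi>" "module_hom scaleM2 (*) \<psi>"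
  shows "balanced_map (\<lambda>a' a''. \<phi> (a' * eta_R (\<psi> a'')))"
  by (simp add: balanced_map_def M2_linearD[OF assms(1)] M2_linearD[OF assms(2)] distrib_left
      distrib_right ring_mapD[OF ring_map_eta_R] scaleM2_dsa_def mult.assoc)

lemma M2_linear_steenrod_mult:
  assumes \<phi>: "module_hom scaleM2 (*) \<phi>" and \<psi>: "module_hom scaleM2 (*) \<psi>"
  shows "module_hom scaleM2 (*) (steenrod_mult \<phi> \<psi>)"
  unfolding M2_linear_iff
proof (intro conjI allI)
  note bal = balanced_map_steenrod_mult[OF assms]
  show "steenrod_mult \<phi> \<psi> (a + b) = steenrod_mult \<phi> \<psi> a + steenrod_mult \<phi> \<psi> b" for a b
    by (simp add: ring_mapD[OF ring_map_comult] tensor_lift_add[OF bal])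
  show "steenrod_mult \<phi> \<psi> (eta_L m * a) = m * steenrod_mult \<phi> \<psi> a" for m a
    using additive_tensor_lift[of "(*) m", OF distrib_left bal, of "comult a"]
    by (simp add: ring_mapD[OF ring_map_comult] comult_generators(1) tensor_lift_mult_left[OF bal]
        mult.assoc M2_linearD[OF \<phi>])
qed

text \<open>Both sides evaluate the trilinear expression \<open>?f\<close> on the twofold
  comultiplication. On the left, right linearity of \<Delta> moves the scalar coming from
  \<open>\<chi>\<close> into the argument of \<open>\<psi>\<close>.\<close>

lemma steenrod_mult_assoc:
  assumes \<phi>: "module_hom scaleM2 (*) \<phi>" and \<psi>: "module_hom scaleM2 (*) \<psi>"
    and \<chi>: "module_hom scaleM2 (*) \<chi>"
  shows "steenrod_mult (steenrod_mult \<phi> \<psi>) \<chi> a = steenrod_mult \<phi> (steenrod_mult \<psi> \<chi>) a"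
proof -
  note lin = M2_linearD[OF \<phi>] M2_linearD[OF \<psi>] M2_linearD[OF \<chi>]
  let ?f = "\<lambda>a b x. \<phi> (a * eta_R (\<psi> (b * eta_R (\<chi> x))))"
  have f: "trilinear_map ?f"
    unfolding trilinear_map_def balanced_map_def
    by (simp add: lin distrib_left distrib_right ring_mapD[OF ring_map_eta_R] scaleM2_dsa_def mult.assoc)
  have "steenrod_mult \<phi> \<psi> (a * eta_R m)
      = tensor_lift (\<lambda>a' a''. \<phi> (a' * eta_R (\<psi> (a'' * eta_R m)))) (comult a)" for a m
    by (simp add: ring_mapD[OF ring_map_comult] comult_eta_R
        tensor_lift_mult_right[OF balanced_map_steenrod_mult[OF \<phi> \<psi>]])
  moreover have "\<phi> (a * eta_R (steenrod_mult \<psi> \<chi> x)) = tensor_lift (?f a) (comult x)" for a x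
    by (rule additive_tensor_lift[of "\<lambda>y. \<phi> (a * eta_R y)",
          OF _ balanced_map_steenrod_mult[OF \<psi> \<chi>]])
      (simp add: lin distrib_left ring_mapD[OF ring_map_eta_R])
  ultimately show ?thesis
    using trilinear_coassoc[OF comult_left_comodule f] by simp
qed

lemma M2_linear_counit: "module_hom scaleM2 (*) counit"
  by (simp add: M2_linear_iff ring_mapD[OF ring_map_counit])

text \<open>By linearity of \<open>\<phi>\<close> and \<open>counit (eta_R m) = m\<close>, both
  \<open>counit (a * eta_R (\<phi> x))\<close> and \<open>\<phi> (counit a *\<^sub>M x)\<close>
  equal \<open>counit a * \<phi> x\<close>.\<close>

lemma steenrod_mult_one_left:
  assumes "module_hom scaleM2 (*) \<phi>"
  shows "steenrod_mult counit \<phi> a = \<phi> a"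
proof -
  have "\<phi> (tensor_lift (\<lambda>a x. counit a *\<^sub>M x) (comult a))
      = tensor_lift (\<lambda>a x. \<phi> (counit a *\<^sub>M x)) (comult a)"
    by (rule additive_tensor_lift[OF M2_linearD(1)[OF assms] balanced_map_counit])
  from this[unfolded comult_counit_left] show ?thesis
    by (simp add: scaleM2_dsa_def M2_linearD[OF assms] ring_mapD[OF ring_map_counit])
qed

lemma steenrod_mult_one_right:
  assumes "module_hom scaleM2 (*) \<phi>"
  shows "steenrod_mult \<phi> counit a = \<phi> a"
  using additive_tensor_lift[OF M2_linearD(1)[OF assms] balanced_map_counit_right, of "comult a"]
  by (simp add: comult_counit_right)

lemma steenrod_pieceD:
  assumes "\<phi> \<in> steenrod_piece e"
  shows "module_hom scaleM2 (*) \<phi>" "a \<in> dsa_piece d \<Longrightarrow> \<phi> a \<in> M2_piece (d + e)"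
  using assms unfolding steenrod_piece_def by blast+

lemma steenrod_piece_zero: "(\<lambda>a. 0) \<in> steenrod_piece e"
  by (simp add: steenrod_piece_def M2_linear_iff graded_ringD(1)[OF graded_ring_M2_piece])

lemma steenrod_piece_add:
  "\<phi> \<in> steenrod_piece e \<Longrightarrow> \<psi> \<in> steenrod_piece e \<Longrightarrow> (\<lambda>a. \<phi> a + \<psi> a) \<in> steenrod_piece e"
  by (simp add: steenrod_piece_def M2_linear_iff graded_ringD(2)[OF graded_ring_M2_piece]
      algebra_simps)

lemma steenrod_piece_mult:
  assumes \<phi>: "\<phi> \<in> steenrod_piece e" and \<psi>: "\<psi> \<in> steenrod_piece e'"
  shows "steenrod_mult \<phi> \<psi> \<in> steenrod_piece (e + e')"
proof -
  note lin = steenrod_pieceD(1)[OF \<phi>] steenrod_pieceD(1)[OF \<psi>]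
  note bal = balanced_map_steenrod_mult[OF lin]
  note M = graded_ringD[OF graded_ring_M2_piece]
  have "tensor_lift (\<lambda>a' a''. \<phi> (a' * eta_R (\<psi> a''))) t \<in> M2_piece (d + (e + e'))"
    if "t \<in> tensor_piece dsa_piece d" for t d
    using that
  proof induction
    case zero
    then show ?case by (simp add: tensor_lift_zero[OF bal] M)
  next
    case (add t a d1 b d2)
    have "a * eta_R (\<psi> b) \<in> dsa_piece (d1 + (d2 + e'))"
      by (intro graded_ringD(4)[OF graded_ring_dsa_piece] eta_R_piece steenrod_pieceD(2)[OF \<psi>] add)
    from steenrod_pieceD(2)[OF \<phi> this] have "\<phi> (a * eta_R (\<psi> b)) \<in> M2_piece (d + (e + e'))"
      unfolding \<open>d1 + d2 = d\<close>[symmetric] by (simp add: ac_simps)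
    with add show ?case by (simp add: tensor_lift_add[OF bal] tensor_lift_pure[OF bal] M)
  qed
  then show ?thesis
    using M2_linear_steenrod_mult[OF lin] comult_piece by (simp add: steenrod_piece_def)
qed

section \<open>Finite sums of homogeneous functionals\<close>

abbreviation steenrod_carrier :: "(dsa \<Rightarrow> M2) set" where
  "steenrod_carrier \<equiv> carrier steenrod_algebra"

lemma steenrod_carrier_iff:
  "\<phi> \<in> steenrod_carrier \<longleftrightarrow>
    (\<exists>E f. finite E \<and> (\<forall>e\<in>E. f e \<in> steenrod_piece e) \<and> \<phi> = (\<lambda>a. \<Sum>e\<in>E. f e a))"
  by (auto simp: steenrod_algebra_def simp del: split_paired_All split_paired_Ex)

lemma steenrod_carrier_piece:
  assumes "\<phi> \<in> steenrod_piece e"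
  shows "\<phi> \<in> steenrod_carrier"
  unfolding steenrod_carrier_iff
  by (rule exI[of _ "{e}"], rule exI[of _ "\<lambda>_. \<phi>"]) (simp add: assms)

lemma steenrod_carrier_add:
  assumes "\<phi> \<in> steenrod_carrier" "\<psi> \<in> steenrod_carrier"
  shows "(\<lambda>a. \<phi> a + \<psi> a) \<in> steenrod_carrier"
proof -
  from assms obtain E f F g
    where E: "finite E" "\<forall>e\<in>E. f e \<in> steenrod_piece e" "\<phi> = (\<lambda>a. \<Sum>e\<in>E. f e a)"
    and F: "finite F" "\<forall>e\<in>F. g e \<in> steenrod_piece e" "\<psi> = (\<lambda>a. \<Sum>e\<in>F. g e a)"
    unfolding steenrod_carrier_iff by blast
  \<comment> \<open>Padding with the zero map, which lies in every piece, gives both families the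
    index set \<open>E \<union> F\<close>.\<close>
  let ?f = "\<lambda>e a. if e \<in> E then f e a else 0" and ?g = "\<lambda>e a. if e \<in> F then g e a else 0"
  have "?f e \<in> steenrod_piece e" "?g e \<in> steenrod_piece e" for e
    using E(2) F(2) steenrod_piece_zero by (cases "e \<in> E", simp_all, cases "e \<in> F", simp_all)
  moreover have "(\<lambda>a. \<phi> a + \<psi> a) = (\<lambda>a. \<Sum>e\<in>E \<union> F. ?f e a + ?g e a)"
  proof
    fix a
    have "\<phi> a = (\<Sum>e\<in>E \<union> F. ?f e a)" "\<psi> a = (\<Sum>e\<in>E \<union> F. ?g e a)"
      unfolding E(3) F(3) using E(1) F(1) by (auto intro!: sum.mono_neutral_cong_left)
    then show "\<phi> a + \<psi> a = (\<Sum>e\<in>E \<union> F. ?f e a + ?g e a)" by (simp add: sum.distrib)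
  qed
  ultimately show ?thesis
    using E(1) F(1) unfolding steenrod_carrier_iff
    by (intro exI[of _ "E \<union> F"] exI[of _ "\<lambda>e a. ?f e a + ?g e a"])
      (simp add: steenrod_piece_add)
qed

lemma steenrod_carrier_induct [consumes 1, case_names zero add]:
  assumes "\<phi> \<in> steenrod_carrier" and "P (\<lambda>a. 0)"
    and step: "\<And>\<phi> \<psi> e. \<phi> \<in> steenrod_carrier \<Longrightarrow> P \<phi> \<Longrightarrow> \<psi> \<in> steenrod_piece e
      \<Longrightarrow> P (\<lambda>a. \<phi> a + \<psi> a)"
  shows "P \<phi>"
proof -
  from assms(1) obtain E f where E: "finite E" "\<forall>e\<in>E. f e \<in> steenrod_piece e"
    and \<phi>: "\<phi> = (\<lambda>a. \<Sum>e\<in>E. f e a)"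
    unfolding steenrod_carrier_iff by blast
  from E show ?thesis
    unfolding \<phi>
  proof (induction E rule: finite_induct)
    case empty
    then show ?case using assms(2) by simp
  next
    case (insert e E)
    have "(\<lambda>a. \<Sum>e\<in>E. f e a) \<in> steenrod_carrier"
      using insert(1,4) unfolding steenrod_carrier_iff by blast
    from step[OF this, of "f e" e] insert show ?case by (simp add: add.commute)
  qed
qed

lemma M2_linear_steenrod_carrier: "\<phi> \<in> steenrod_carrier \<Longrightarrow> module_hom scaleM2 (*) \<phi>"
proof (induction rule: steenrod_carrier_induct)
  case zero
  then show ?case by (simp add: M2_linear_iff)
next
  case (add \<phi> \<psi> e)
  then show ?case using steenrod_pieceD(1)[OF \<open>\<psi> \<in> steenrod_piece e\<close>] by (simp add: M2_linear_iff algebra_simps)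
qed

lemma steenrod_mult_add_left:
  "steenrod_mult (\<lambda>a. \<phi> a + \<phi>' a) \<psi> a = steenrod_mult \<phi> \<psi> a + steenrod_mult \<phi>' \<psi> a"
  by (rule tensor_lift_fun_add)

lemma steenrod_mult_add_right:
  assumes "module_hom scaleM2 (*) \<phi>"
  shows "steenrod_mult \<phi> (\<lambda>a. \<psi> a + \<psi>' a) a = steenrod_mult \<phi> \<psi> a + steenrod_mult \<phi> \<psi>' a"
  by (simp add: ring_mapD[OF ring_map_eta_R] distrib_left M2_linearD[OF assms] tensor_lift_fun_add)

lemma tensor_lift_zero_fun: "tensor_lift (\<lambda>a n. 0) t = 0"
  by (simp add: tensor_lift_def tensor_lift_rep_def)

text \<open>Biadditivity reduces this to homogeneous factors: \<open>piece\<close> lets the right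
  factor vary with a homogeneous left one, then the left factor is built up.\<close>

lemma steenrod_carrier_mult:
  assumes \<phi>: "\<phi> \<in> steenrod_carrier" and \<psi>: "\<psi> \<in> steenrod_carrier"
  shows "steenrod_mult \<phi> \<psi> \<in> steenrod_carrier"
proof -
  note zero = steenrod_carrier_piece[OF steenrod_piece_zero]
  have piece: "steenrod_mult \<phi> \<psi> \<in> steenrod_carrier" if "\<phi> \<in> steenrod_piece e" for \<phi> e
    using \<psi>
  proof (induction rule: steenrod_carrier_induct)
    case zero
    show ?case
      by (simp add: ring_mapD[OF ring_map_eta_R] M2_linearD[OF steenrod_pieceD(1)[OF that]]
          tensor_lift_zero_fun \<open>(\<lambda>a. 0) \<in> steenrod_carrier\<close>)
  next
    case (add \<psi> \<psi>' e')
    show ?case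
      unfolding steenrod_mult_add_right[OF steenrod_pieceD(1)[OF that]]
      by (rule steenrod_carrier_add[OF add.IH
            steenrod_carrier_piece[OF steenrod_piece_mult[OF that add.hyps(2)]]])
  qed
  from \<phi> show ?thesis
  proof (induction rule: steenrod_carrier_induct)
    case zero
    show ?case by (simp add: tensor_lift_zero_fun \<open>(\<lambda>a. 0) \<in> steenrod_carrier\<close>)
  next
    case (add \<phi> \<phi>' e)
    show ?case
      unfolding steenrod_mult_add_left
      by (rule steenrod_carrier_add[OF add.IH piece[OF add.hyps(2)]])
  qed
qed

section \<open>The ring structure and its action on a comodule\<close>

lemma steenrod_algebra_simps:
  "mult steenrod_algebra \<phi> \<psi> = steenrod_mult \<phi> \<psi>"
  "one steenrod_algebra = counit"
  "zero steenrod_algebra = (\<lambda>a. 0)"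
  "add steenrod_algebra \<phi> \<psi> = (\<lambda>a. \<phi> a + \<psi> a)"
  by (simp_all add: steenrod_algebra_def)

lemma counit_steenrod_carrier: "counit \<in> steenrod_carrier"
  by (rule steenrod_carrier_piece[of _ 0])
    (simp add: steenrod_piece_def M2_linear_counit counit_piece)

lemma ring_steenrod_algebra: "ring steenrod_algebra"
proof (rule ringI)
  note lin = M2_linear_steenrod_carrier
  show "abelian_group steenrod_algebra"
  proof (rule abelian_groupI)
    fix \<phi> assume "\<phi> \<in> steenrod_carrier"
    then show "\<exists>\<psi>\<in>steenrod_carrier. \<psi> \<oplus>\<^bsub>steenrod_algebra\<^esub> \<phi> = \<zero>\<^bsub>steenrod_algebra\<^esub>"
      \<comment> \<open>In characteristic 2 every functional is its own negative.\<close>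
      by (intro bexI[of _ \<phi>]) (simp_all add: steenrod_algebra_simps M2_char_2)
  qed (simp_all add: steenrod_algebra_simps steenrod_carrier_add add_ac
      steenrod_carrier_piece[OF steenrod_piece_zero])
  show "Group.monoid steenrod_algebra"
    by (rule monoidI)
      (simp_all add: steenrod_algebra_simps steenrod_carrier_mult counit_steenrod_carrier lin
        steenrod_mult_assoc steenrod_mult_one_left steenrod_mult_one_right)
qed (simp_all add: steenrod_algebra_simps steenrod_mult_add_left
    steenrod_mult_add_right M2_linear_steenrod_carrier)

text \<open>The scalar \<open>\<chi> (c a)\<close> produced by the first action passes through the
  linear coaction, enters the next tensor as \<open>eta_L\<close> and leaves c as
  \<open>eta_R\<close>. Coassociativity gathers the two tensor factors into one \<Delta> a, and the
  formula for \<Delta> (c a) recognizes the product of \<open>\<phi>\<close> and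
  \<open>\<chi>\<close> at \<open>c a\<close>.\<close>

lemma comodule_act_mult:
  fixes \<psi> :: "'n::M2_module \<Rightarrow> 'n dsa_tensor"
  assumes \<psi>: "left_comodule \<psi>"
    and \<phi>: "module_hom scaleM2 (*) \<phi>" and \<chi>: "module_hom scaleM2 (*) \<chi>"
  shows "comodule_act \<psi> (steenrod_mult \<phi> \<chi>) n = comodule_act \<psi> \<phi> (comodule_act \<psi> \<chi> n)"
proof -
  interpret module_hom scaleM2 scaleM2 \<psi> using \<psi> by (simp add: left_comodule_def)
  note lin = M2_linearD[OF \<phi>] M2_linearD[OF \<chi>]
  note cj = ring_mapD[OF ring_map_conjugation] conjugation_eta_L conjugation_eta_R
  note distribs = distrib_left distrib_right scaleM2_add_left scaleM2_add_right
  have \<phi>_mid: "\<phi> (a * eta_L m * b) = m * \<phi> (a * b)" for a b m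
    using lin(2)[of m "a * b"] by (simp add: mult.left_commute mult.assoc)
  have \<chi>_right: "\<chi> (a * eta_L m) = m * \<chi> a" for a m
    using lin(5)[of m a] by (simp add: mult.commute)
  \<comment> \<open>The first factor meets \<open>\<chi>\<close>, which acts first;
    \<open>conj_flip\<close> later matches this with the order in
    \<open>steenrod_mult\<close>.\<close>
  let ?f = "\<lambda>a b (x::'n). \<phi> (conjugation b * eta_R (\<chi> (conjugation a))) *\<^sub>M x"
  let ?A = "tensor_lift (\<lambda>a (x::'n). \<phi> (conjugation a) *\<^sub>M x)"
  note bal\<phi> = balanced_map_comodule_act[OF \<phi>, unfolded o_def]
  note bal\<chi> = balanced_map_comodule_act[OF \<chi>, unfolded o_def]
  have f: "trilinear_map ?f"
    unfolding trilinear_map_def balanced_map_def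
  proof (intro conjI allI)
    show "?f (a * eta_R m) b x = ?f a (eta_L m * b) x" for a b m x
      by (simp only: cj \<chi>_right ring_mapD[OF ring_map_eta_R] mult_ac)
    show "?f a (b * eta_R m) x = ?f a b (m *\<^sub>M x)" for a b m x
      by (simp only: cj \<phi>_mid scaleM2_scaleM2 mult.commute[of _ m])
  qed (simp_all add: lin cj distribs ring_mapD[OF ring_map_eta_R])
  have A: "?A (m *\<^sub>M t) = tensor_lift (\<lambda>b y. \<phi> (conjugation b * eta_R m) *\<^sub>M y) t" for m t
  proof -
    have g: "balanced_map (\<lambda>b (y::'n). \<phi> (conjugation b * eta_R m) *\<^sub>M y)"
      unfolding balanced_map_def
    proof (intro conjI allI)
      show "\<phi> (conjugation (b * eta_R m') * eta_R m) *\<^sub>M y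
          = \<phi> (conjugation b * eta_R m) *\<^sub>M m' *\<^sub>M y" for b m' and y :: 'n
        by (simp only: cj \<phi>_mid scaleM2_scaleM2 mult.commute[of _ m'])
    qed (simp_all add: lin cj distribs)
    show ?thesis
      by (induction t rule: dsa_tensor_induct)
        (simp_all add: scaleM2_tensor_zero scaleM2_tensor_add scaleM2_pure_tensor cj
          tensor_lift_zero tensor_lift_add tensor_lift_pure bal\<phi> g mult.commute)
  qed
  have "comodule_act \<psi> \<phi> (comodule_act \<psi> \<chi> n)
      = tensor_lift (\<lambda>a x. ?A (\<psi> (\<chi> (conjugation a) *\<^sub>M x))) (\<psi> n)"
    unfolding comodule_act_def o_def
    by (rule additive_tensor_lift[OF _ bal\<chi>]) (simp add: add tensor_lift_add[OF bal\<phi>])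
  also have "\<dots> = tensor_lift (\<lambda>a x. tensor_lift (?f a) (\<psi> x)) (\<psi> n)"
    by (simp only: scale A)
  also have "\<dots> = tensor_lift (\<lambda>a x. tensor_lift (\<lambda>a' a''. ?f a' a'' x) (comult a)) (\<psi> n)"
    by (rule trilinear_coassoc[OF \<psi> f, symmetric])
  also have "\<dots> = comodule_act \<psi> (steenrod_mult \<phi> \<chi>) n"
  proof -
    note bal = balanced_map_steenrod_mult[OF \<phi> \<chi>]
    have "steenrod_mult \<phi> \<chi> (conjugation a) *\<^sub>M x
        = tensor_lift (\<lambda>a' a''. ?f a' a'' x) (comult a)" for a x
    proof -
      have "steenrod_mult \<phi> \<chi> (conjugation a) *\<^sub>M x
          = tensor_lift (\<lambda>p q. \<phi> (p * eta_R (\<chi> q))) (conj_flip (comult a)) *\<^sub>M x"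
        by (simp only: comult_conjugation)
      also have "\<dots> = tensor_lift (\<lambda>a' a''. tensor_lift (\<lambda>p q. \<phi> (p * eta_R (\<chi> q)))
          (conjugation a'' \<otimes>\<^sub>A conjugation a') *\<^sub>M x) (comult a)"
        unfolding conj_flip_def
        by (rule additive_tensor_lift[OF _ balanced_map_conj_flip])
          (simp add: tensor_lift_add[OF bal] scaleM2_add_left)
      finally show ?thesis by (simp only: tensor_lift_pure[OF bal])
    qed
    then show ?thesis by (simp add: comodule_act_def)
  qed
  finally show ?thesis ..
qed

lemma comodule_act_piece:
  assumes G: "M2_bigrading G" and "\<psi> n \<in> tensor_piece G d" and \<phi>: "\<phi> \<in> steenrod_piece e"
  shows "comodule_act \<psi> \<phi> n \<in> G (d + e)"
proof -
  note bal = balanced_map_comodule_act[OF steenrod_pieceD(1)[OF \<phi>], unfolded o_def]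
  have G_zero: "0 \<in> G d" and diff: "x \<in> G d \<Longrightarrow> y \<in> G d \<Longrightarrow> x - y \<in> G d"
    and scale: "m \<in> M2_piece d \<Longrightarrow> x \<in> G e \<Longrightarrow> m *\<^sub>M x \<in> G (d + e)" for d e x y m
    using G unfolding M2_bigrading_def by blast+
  \<comment> \<open>A bigrading is given by closure under differences, so the sum is read as
    \<open>x - (0 - y)\<close>.\<close>
  have G_add: "x + y \<in> G d" if "x \<in> G d" "y \<in> G d" for x y d
    using diff[OF that(1) diff[OF G_zero that(2)]] by simp
  from assms(2) show ?thesis
    unfolding comodule_act_def o_def
  proof induction
    case zero
    show ?case unfolding tensor_lift_zero[OF bal] by (rule G_zero)
  next
    case (add t a d1 x d2)
    have "\<phi> (conjugation a) *\<^sub>M x \<in> G (d1 + e + d2)"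
      by (intro scale steenrod_pieceD(2)[OF \<phi>] conjugation_piece add)
    also have "d1 + e + d2 = d + e"
      unfolding \<open>d1 + d2 = d\<close>[symmetric] by (simp add: ac_simps)
    finally show ?case
      unfolding tensor_lift_add[OF bal] tensor_lift_pure[OF bal]
      by (rule G_add[OF add.IH])
  qed
qed

theorem proposition3p3:
  fixes \<psi> :: "'n::M2_module \<Rightarrow> 'n dsa_tensor"
  assumes "left_comodule \<psi>"
  shows "left_module steenrod_algebra (comodule_act \<psi>) \<and>
    (\<forall>G. M2_bigrading G \<and> (\<forall>d. \<forall>n\<in>G d. \<psi> n \<in> tensor_piece G d) \<longrightarrow>
      (\<forall>e. \<forall>\<phi>\<in>steenrod_piece e. \<forall>d. \<forall>n\<in>G d. comodule_act \<psi> \<phi> n \<in> G (d + e)))"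
proof (intro conjI allI impI ballI)
  show "left_module steenrod_algebra (comodule_act \<psi>)"
  proof (intro left_module.intro left_module_axioms.intro ring_steenrod_algebra)
    note lin = M2_linear_steenrod_carrier
    interpret module_hom scaleM2 scaleM2 \<psi> using assms by (simp add: left_comodule_def)
    fix \<phi> \<chi> :: "dsa \<Rightarrow> M2" and x y :: 'n
    assume \<phi>: "\<phi> \<in> steenrod_carrier"
    show "comodule_act \<psi> \<phi> (x + y) = comodule_act \<psi> \<phi> x + comodule_act \<psi> \<phi> y"
      by (simp only: comodule_act_def add tensor_lift_add[OF balanced_map_comodule_act[OF lin[OF \<phi>]]])
    assume \<chi>: "\<chi> \<in> steenrod_carrier"
    show "comodule_act \<psi> (\<phi> \<oplus>\<^bsub>steenrod_algebra\<^esub> \<chi>) x = comodule_act \<psi> \<phi> x + comodule_act \<psi> \<chi> x"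
      by (simp add: comodule_act_def steenrod_algebra_simps scaleM2_add_left tensor_lift_fun_add)
    show "comodule_act \<psi> (\<phi> \<otimes>\<^bsub>steenrod_algebra\<^esub> \<chi>) x = comodule_act \<psi> \<phi> (comodule_act \<psi> \<chi> x)"
      unfolding steenrod_algebra_simps by (rule comodule_act_mult[OF assms lin[OF \<phi>] lin[OF \<chi>]])
  next
    show "comodule_act \<psi> \<one>\<^bsub>steenrod_algebra\<^esub> x = x" for x
      using assms
      by (simp add: comodule_act_def steenrod_algebra_simps counit_conjugation left_comodule_def)
  qed
qed (use comodule_act_piece in blast)

end
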